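(* Let $g\in L_q^2(\mathbb{R}_{q,+},x^{2\alpha+1}d_qx)$ be a $q$-wavelet associated with the $q$-Bessel operator. Then for every $f\in L_q^2(\mathbb{R}_{q,+},x^{2\alpha+1}d_qx)$, $$f(x)=\frac{c_{\alpha,q}}{C_g}\int_0^\infty\int_0^\infty\Psi^{\alpha}_{q,g}(f)(a,b)\,g_{a,b}(x)\,b^{2\alpha+1}\frac{d_qa\,d_qb}{a^2},\qquad x\in\mathbb{R}_{q,+}.$$
   Context: Fix $q\in\,]0,1[$ with $\frac{\log(1-q)}{\log q}\in\mathbb{Z}$ and $\alpha>-\frac12$. Functions are complex valued. $(a;q)_0=1$, $(a;q)_n=\prod_{k=0}^{n-1}(1-aq^k)$, $(a;q)_\infty=\prod_{k\ge0}(1-aq^k)$; $\Gamma_q(x)=\frac{(q;q)_\infty}{(q^x;q)_\infty}(1-q)^{1-x}$, and $\Gamma_{q^2}$ is the same with $q$ replaced by $q^2$. $\mathbb{R}_{q,+}=\{q^n:n\in\mathbb{Z}\}$, $\widetilde{\mathbb{R}}_{q,+}=\mathbb{R}_{q,+}\cup\{0\}$. Jackson integral: $\int_0^\infty f(x)\,d_qx=(1-q)\sum_{n\in\mathbb{Z}}f(q^n)q^n$. $L_q^2(\mathbb{R}_{q,+},x^{2\alpha+1}d_qx)$ is the space of functions on $\mathbb{R}_{q,+}$ with $\|f\|_{2,\alpha,q}=\left(\int_0^\infty|f(x)|^2x^{2\alpha+1}d_qx\right)^{1/2}<\infty$ (its elements are regarded as even functions). Normalized $q$-Bessel function: $j_\alpha^{(3)}(z;q^2)=\sum_{n\ge0}\frac{(-1)^nq^{n(n-1)}(1-q)^{2n}z^{2n}}{(q^2;q^2)_n(q^{2\alpha+2};q^2)_n}$.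 $q$-Bessel Fourier transform: $\mathcal{F}_{\alpha,q}(f)(\lambda)=c_{\alpha,q}\int_0^\infty f(x)j_\alpha^{(3)}(\lambda x;q^2)x^{2\alpha+1}d_qx$ with $c_{\alpha,q}=\frac{(1+q^{-1})^{-\alpha}}{\Gamma_{q^2}(\alpha+1)}$; it is an isomorphism of $L_q^2(\mathbb{R}_{q,+},x^{2\alpha+1}d_qx)$ with $\mathcal{F}_{\alpha,q}^{-1}=q^{-4\alpha-2}\mathcal{F}_{\alpha,q}$. For $x\in\widetilde{\mathbb{R}}_{q,+}$ the $q$-Bessel translation $T_{q,x}^\alpha$ acts on $L_q^2(\mathbb{R}_{q,+},x^{2\alpha+1}d_qx)$ by $\mathcal{F}_{\alpha,q}(T_{q,x}^\alpha f)(\lambda)=j_\alpha^{(3)}(\lambda x;q^2)\mathcal{F}_{\alpha,q}(f)(\lambda)$, $\lambda\in\mathbb{R}_{q,+}$. A $q$-wavelet associated with the $q$-Bessel operator is an even $g\in L_q^2(\mathbb{R}_{q,+},x^{2\alpha+1}d_qx)$ with $0<C_g=\int_0^\infty|\mathcal{F}_{\alpha,q}(g)(a)|^2\frac{d_qa}{a}<\infty$. For $a\in\mathbb{R}_{q,+}$, $b\in\widetilde{\mathbb{R}}_{q,+}$: $g_a(x)=a^{-2\alpha-2}g(x/a)$ and $g_{a,b}=\sqrt a\,T_{q,b}^\alpha(g_a)$. The continuous $q$-wavelet transform associated with the $q$-Bessel operator is $\Psi^{\alpha}_{q,g}(f)(a,b)=c_{\alpha,q}\int_0^\infty f(x)\overline{g_{a,b}(x)}\,x^{2\alpha+1}d_qx$.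 *)

theory Defs
  imports "HOL-Analysis.Analysis"
begin

definition qpoch :: "real \<Rightarrow> real \<Rightarrow> nat \<Rightarrow> real" where
  "qpoch a q n = (\<Prod>k<n. 1 - a * q ^ k)"

definition qpoch_inf :: "real \<Rightarrow> real \<Rightarrow> real" where
  "qpoch_inf a q = prodinf (\<lambda>k. 1 - a * q ^ k)"

definition qGamma :: "real \<Rightarrow> real \<Rightarrow> real" where
  "qGamma q x = qpoch_inf q q / qpoch_inf (q powr x) q * (1 - q) powr (1 - x)"

definition Rq_pos :: "real \<Rightarrow> real set" where
  "Rq_pos q = range (\<lambda>n::int. q powi n)"

(* A function on Rq_pos q is represented by a total function on the reals;
   apart from the evenness of a wavelet, only its values on Rq_pos q matter below. *)

definition jackson_integrable :: "real \<Rightarrow> (real \<Rightarrow> 'a::real_normed_vector) \<Rightarrow> bool" where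
  "jackson_integrable q f \<longleftrightarrow>
     (\<lambda>n::int. (q powi n) *\<^sub>R f (q powi n)) abs_summable_on UNIV"

definition jackson_integral :: "real \<Rightarrow> (real \<Rightarrow> 'a::real_normed_vector) \<Rightarrow> 'a" where
  "jackson_integral q f = (1 - q) *\<^sub>R (\<Sum>\<^sub>\<infinity>n::int. (q powi n) *\<^sub>R f (q powi n))"

(* Double Jackson integral: one sum over all pairs of integers.  Under absolute
   convergence it equals both iterated integrals, see jackson_integral2_iterated. *)

definition jackson_integrable2 :: "real \<Rightarrow> (real \<Rightarrow> real \<Rightarrow> 'a::real_normed_vector) \<Rightarrow> bool" where
  "jackson_integrable2 q F \<longleftrightarrow>
     (\<lambda>(m::int, n::int). (q powi m * q powi n) *\<^sub>R F (q powi m) (q powi n)) abs_summable_on UNIV"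

definition jackson_integral2 :: "real \<Rightarrow> (real \<Rightarrow> real \<Rightarrow> 'a::real_normed_vector) \<Rightarrow> 'a" where
  "jackson_integral2 q F =
     (1 - q)\<^sup>2 *\<^sub>R (\<Sum>\<^sub>\<infinity>(m::int, n::int). (q powi m * q powi n) *\<^sub>R F (q powi m) (q powi n))"

lemma jackson_integral2_iterated:
  fixes F :: "real \<Rightarrow> real \<Rightarrow> 'a::banach"
  assumes "jackson_integrable2 q F"
  shows "jackson_integral2 q F = jackson_integral q (\<lambda>a. jackson_integral q (\<lambda>b. F a b))"
    and "jackson_integral2 q F = jackson_integral q (\<lambda>b. jackson_integral q (\<lambda>a. F a b))"
proof -
  let ?G = "\<lambda>m n::int. (q powi m * q powi n) *\<^sub>R F (q powi m) (q powi n)"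
  have s: "(\<lambda>(m, n). ?G m n) summable_on UNIV \<times> UNIV"
    using assms abs_summable_summable unfolding jackson_integrable2_def by fastforce
  have 1: "(\<Sum>\<^sub>\<infinity>(m, n). ?G m n) = (\<Sum>\<^sub>\<infinity>m. \<Sum>\<^sub>\<infinity>n. ?G m n)"
    using infsum_Sigma'_banach[of ?G UNIV "\<lambda>_. UNIV"] s by simp
  have 2: "(\<Sum>\<^sub>\<infinity>m. \<Sum>\<^sub>\<infinity>n. ?G m n) = (\<Sum>\<^sub>\<infinity>n. \<Sum>\<^sub>\<infinity>m. ?G m n)"
    using infsum_swap_banach[OF s] .
  show "jackson_integral2 q F = jackson_integral q (\<lambda>a. jackson_integral q (\<lambda>b. F a b))"
    unfolding jackson_integral2_def 1 jackson_integral_def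
    by (simp flip: infsum_scaleR_right add: power2_eq_square mult_ac)
  show "jackson_integral2 q F = jackson_integral q (\<lambda>b. jackson_integral q (\<lambda>a. F a b))"
    unfolding jackson_integral2_def 1 2 jackson_integral_def
    by (simp flip: infsum_scaleR_right add: power2_eq_square mult_ac)
qed

definition Lq2 :: "real \<Rightarrow> real \<Rightarrow> (real \<Rightarrow> complex) set" where
  "Lq2 q \<alpha> = {f. jackson_integrable q (\<lambda>x. (cmod (f x))\<^sup>2 * x powr (2 * \<alpha> + 1))}"

definition qBessel :: "real \<Rightarrow> real \<Rightarrow> real \<Rightarrow> real" where
  "qBessel q \<alpha> z =
     (\<Sum>n. (-1) ^ n * q ^ (n * (n - 1)) * (1 - q) ^ (2 * n) * z ^ (2 * n) /
          (qpoch (q\<^sup>2) (q\<^sup>2) n * qpoch (q powr (2 * \<alpha> + 2)) (q\<^sup>2) n))"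

definition qc :: "real \<Rightarrow> real \<Rightarrow> real" where
  "qc q \<alpha> = (1 + 1 / q) powr (-\<alpha>) / qGamma (q\<^sup>2) (\<alpha> + 1)"

definition qFourier :: "real \<Rightarrow> real \<Rightarrow> (real \<Rightarrow> complex) \<Rightarrow> real \<Rightarrow> complex" where
  "qFourier q \<alpha> f l =
     of_real (qc q \<alpha>) *
     jackson_integral q (\<lambda>x. f x * of_real (qBessel q \<alpha> (l * x)) * of_real (x powr (2 * \<alpha> + 1)))"

(* The transform is injective on Lq2 q \<alpha> (as functions on Rq_pos q), so the chosen
   function is determined on Rq_pos q. *)
definition qtranslation :: "real \<Rightarrow> real \<Rightarrow> real \<Rightarrow> (real \<Rightarrow> complex) \<Rightarrow> real \<Rightarrow> complex" where
  "qtranslation q \<alpha> x f =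
     (SOME h. h \<in> Lq2 q \<alpha> \<and>
        (\<forall>l \<in> Rq_pos q. qFourier q \<alpha> h l = of_real (qBessel q \<alpha> (l * x)) * qFourier q \<alpha> f l))"

definition wavelet_const :: "real \<Rightarrow> real \<Rightarrow> (real \<Rightarrow> complex) \<Rightarrow> real" where
  "wavelet_const q \<alpha> g = jackson_integral q (\<lambda>a. (cmod (qFourier q \<alpha> g a))\<^sup>2 / a)"

definition q_wavelet :: "real \<Rightarrow> real \<Rightarrow> (real \<Rightarrow> complex) \<Rightarrow> bool" where
  "q_wavelet q \<alpha> g \<longleftrightarrow>
     g \<in> Lq2 q \<alpha> \<and>
     (\<forall>x \<in> Rq_pos q. g (- x) = g x) \<and>
     jackson_integrable q (\<lambda>a. (cmod (qFourier q \<alpha> g a))\<^sup>2 / a) \<and>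
     0 < wavelet_const q \<alpha> g"

definition qdilation :: "real \<Rightarrow> (real \<Rightarrow> complex) \<Rightarrow> real \<Rightarrow> real \<Rightarrow> complex" where
  "qdilation \<alpha> g a x = of_real (a powr (- 2 * \<alpha> - 2)) * g (x / a)"

definition wavelet_atom ::
    "real \<Rightarrow> real \<Rightarrow> (real \<Rightarrow> complex) \<Rightarrow> real \<Rightarrow> real \<Rightarrow> real \<Rightarrow> complex" where
  "wavelet_atom q \<alpha> g a b x = of_real (sqrt a) * qtranslation q \<alpha> b (qdilation \<alpha> g a) x"

definition wavelet_transform ::
    "real \<Rightarrow> real \<Rightarrow> (real \<Rightarrow> complex) \<Rightarrow> (real \<Rightarrow> complex) \<Rightarrow> real \<Rightarrow> real \<Rightarrow> complex" where
  "wavelet_transform q \<alpha> g f a b =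
     of_real (qc q \<alpha>) *
     jackson_integral q (\<lambda>x. f x * cnj (wavelet_atom q \<alpha> g a b x) * of_real (x powr (2 * \<alpha> + 1)))"

end

theory Submission
  imports Defs
begin

text \<open>
  On the lattice of integer powers of \<open>q\<close> everything becomes a statement about sequences indexed by
  the integers. Put \<open>r = q powr (\<alpha> + 1)\<close> and send a function \<open>h\<close> to the sequence
  \<open>n \<mapsto> r\<^sup>n * h (q\<^sup>n)\<close>; this identifies \<open>Lq2 q \<alpha>\<close> with the square summable sequences. Since
  the Bessel kernel depends on \<open>l * x\<close> only, the \<open>q\<close>-Bessel Fourier transform becomes, up to a
  constant \<open>\<kappa>\<close> and the weight \<open>r powi (- l)\<close>, a Hankel operator
  \<open>x \<mapsto> (n \<mapsto> \<Sum>k. v (n + k) * x k)\<close> with a real kernel \<open>v\<close>.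

  The analytic heart is the orthogonality relation \<open>(\<Sum>k. v (k + n) * v (k + m)) = \<delta>\<^sub>n\<^sub>m\<close> for the
  third Jackson (Hahn-Exton) \<open>q\<close>-Bessel function. It has an algebraic cause: \<open>v\<close> is a correlation
  of two summable sequences that are inverse to each other under convolution
  (\<open>correlation_orthogonal\<close>). They are rescaled coefficients of the two Euler series
  \<open>(w;p)\<^sub>\<infinity>\<close> and \<open>1 / (w;p)\<^sub>\<infinity>\<close> in base \<open>p = q\<^sup>2\<close>. The Bessel series takes this form
  because a double series is symmetric in its two variables (\<open>euler_series_symmetric\<close>,
  \<open>bessel_series_eq\<close>). The hypothesis that \<open>ln (1 - q) / ln q\<close> is an integer says that the factor
  \<open>1 - q\<close> inside the Bessel function is itself a power of \<open>q\<close>, so that it only shifts the index of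
  \<open>v\<close> (\<open>qBessel_unitary\<close>).

  Consequently the Hankel operator \<open>U\<close> is a symmetric unitary involution (\<open>hankel_involution\<close>,
  \<open>hankel_parseval\<close>). Let \<open>x\<close> be the sequence of \<open>f\<close> and let \<open>\<gamma>\<close> be the Fourier transform of the
  wavelet on the lattice. At \<open>a = q\<^sup>m\<close>, \<open>b = q\<^sup>k\<close> both the wavelet transform of \<open>f\<close> and the value
  of the atom at \<open>q\<^sup>n\<close> are, up to scalars, values at \<open>k\<close> of \<open>U\<close>, applied to
  \<open>l \<mapsto> U x l * cnj (\<gamma> (m + l))\<close> and to \<open>l \<mapsto> v (n + l) * \<gamma> (m + l)\<close>. Parseval removes the sum
  over \<open>k\<close>; the sum over \<open>m\<close> of \<open>|\<gamma> (m + l)|\<^sup>2\<close> does not depend on \<open>l\<close> and gives the wavelet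
  constant; what remains is \<open>U (U x) n = x n\<close> (\<open>discrete_reconstruction\<close>). All scalars cancel
  because \<open>\<kappa>\<close> is the product of \<open>1 - q\<close>, \<open>qc q \<alpha>\<close> and the constant that relates the Bessel
  function to \<open>v\<close>.
\<close>

(* Two constants share this infix; here it denotes unconditional norm summability,
   the one used by infsum. *)
no_notation Infinite_Set_Sum.abs_summable_on (infix \<open>abs'_summable'_on\<close> 50)

section \<open>Absolutely convergent double sums\<close>

lemma abs_summable_times:
  fixes f :: "'a \<Rightarrow> 'c::{real_normed_div_algebra, banach}" and g :: "'b \<Rightarrow> 'c"
  assumes "f abs_summable_on A" and "g abs_summable_on B"
  shows "(\<lambda>(x, y). f x * g y) abs_summable_on A \<times> B"
proof -
  have "(\<lambda>x. norm (f x) * (\<Sum>\<^sub>\<infinity>y\<in>B. norm (g y))) summable_on A"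
    using assms(1) by (rule summable_on_cmult_left)
  then have "(\<lambda>x. norm (\<Sum>\<^sub>\<infinity>y\<in>B. norm (f x * g y))) summable_on A"
    by (simp add: norm_mult infsum_cmult_right' infsum_nonneg)
  moreover have "(\<lambda>y. norm (f x * g y)) summable_on B" for x
    using assms(2) by (simp add: norm_mult summable_on_cmult_right)
  ultimately show ?thesis
    by (subst Infinite_Sum.abs_summable_on_Sigma_iff) simp
qed

lemma infsum_times:
  fixes f :: "'a \<Rightarrow> 'c::{real_normed_field, banach}" and g :: "'b \<Rightarrow> 'c"
  assumes "f abs_summable_on UNIV" and "g abs_summable_on UNIV"
  shows "(\<Sum>\<^sub>\<infinity>(x, y). f x * g y) = (\<Sum>\<^sub>\<infinity>x. f x) * (\<Sum>\<^sub>\<infinity>y. g y)"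
  using infsum_Sigma'_banach[of "\<lambda>x y. f x * g y" UNIV "\<lambda>_. UNIV"]
    abs_summable_summable[OF abs_summable_times[OF assms]]
  by (simp add: infsum_cmult_right' infsum_cmult_left')

lemma abs_summable_slice:
  assumes "(\<lambda>(x, y). f x y) abs_summable_on UNIV"
  shows "f x abs_summable_on UNIV"
  using assms Infinite_Sum.abs_summable_on_Sigma_iff[of "\<lambda>(x, y). f x y" UNIV "\<lambda>_. UNIV"]
  by simp

lemma abs_summable_marginal:
  fixes f :: "'a \<Rightarrow> 'b \<Rightarrow> 'c::banach"
  assumes "(\<lambda>(x, y). f x y) abs_summable_on UNIV"
  shows "(\<lambda>x. \<Sum>\<^sub>\<infinity>y. f x y) abs_summable_on UNIV"
proof -
  have "(\<lambda>x. \<Sum>\<^sub>\<infinity>y. norm (f x y)) summable_on UNIV"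
    using assms Infinite_Sum.abs_summable_on_Sigma_iff[of "\<lambda>(x, y). f x y" UNIV "\<lambda>_. UNIV"]
    by (simp add: abs_summable_summable)
  then show ?thesis
    by (rule Infinite_Sum.abs_summable_on_comparison_test')
       (use abs_summable_slice[OF assms] norm_infsum_bound in blast)
qed

lemma infsum_swap_abs:
  fixes f :: "'a \<Rightarrow> 'b \<Rightarrow> 'c::banach"
  assumes "(\<lambda>(x, y). f x y) abs_summable_on UNIV"
  shows "(\<Sum>\<^sub>\<infinity>x. \<Sum>\<^sub>\<infinity>y. f x y) = (\<Sum>\<^sub>\<infinity>y. \<Sum>\<^sub>\<infinity>x. f x y)"
  using infsum_swap_banach[of f UNIV UNIV] abs_summable_summable[OF assms] by simp

lemma infsum_of_real:
  fixes f :: "'a \<Rightarrow> real"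
  shows "(\<Sum>\<^sub>\<infinity>x\<in>A. complex_of_real (f x)) = of_real (\<Sum>\<^sub>\<infinity>x\<in>A. f x)"
proof (rule infsum_bounded_linear_strong[OF _ bounded_linear_of_real])
  show "(\<lambda>x. complex_of_real (f x)) summable_on A \<longleftrightarrow> f summable_on A"
    using summable_on_Re[of "\<lambda>x. complex_of_real (f x)" A] summable_on_of_real[of f A] by auto
qed

lemma infsum_shift_int:
  fixes f :: "int \<Rightarrow> 'a::{comm_monoid_add, t2_space}"
  shows "(\<Sum>\<^sub>\<infinity>k. f (k + n)) = (\<Sum>\<^sub>\<infinity>k. f k)"
  by (intro infsum_reindex_bij_witness[where i = "\<lambda>k. k - n" and j = "\<lambda>k. k + n"]) auto

lemma summable_shift_int:
  fixes f :: "int \<Rightarrow> 'a::{comm_monoid_add, t2_space}"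
  shows "(\<lambda>k. f (k + n)) summable_on UNIV \<longleftrightarrow> f summable_on UNIV"
  by (intro summable_on_reindex_bij_witness[where i = "\<lambda>k. k - n" and j = "\<lambda>k. k + n"]) auto

lemma abs_summable_bounded:
  assumes "f abs_summable_on UNIV"
  shows "norm (f x) \<le> (\<Sum>\<^sub>\<infinity>y. norm (f y))"
  using finite_sum_le_infsum[OF assms, of "{x}"] by simp

lemma abs_summable_mult_bounded:
  fixes f g :: "'a \<Rightarrow> 'c::real_normed_div_algebra"
  assumes "f abs_summable_on A" and "\<And>x. norm (g x) \<le> B"
  shows "(\<lambda>x. f x * g x) abs_summable_on A"
proof (rule Infinite_Sum.abs_summable_on_comparison_test')
  show "(\<lambda>x. norm (f x) * B) summable_on A"
    using assms(1) by (rule summable_on_cmult_left)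
  show "norm (f x * g x) \<le> norm (f x) * B" for x
    using assms(2)[of x] by (simp add: norm_mult mult_left_mono)
qed

text \<open>The summability behind every exchange of sums with a translated factor: \<open>(m, l) \<mapsto> (m + l, l)\<close>
  is a bijection, so this is the tensor product of two absolutely summable families.\<close>

lemma abs_summable_shifted_times:
  fixes f g :: "int \<Rightarrow> 'c::{real_normed_div_algebra, banach}"
  assumes "f abs_summable_on UNIV" and "g abs_summable_on UNIV"
  shows "(\<lambda>(m, l). f (m + l) * g l) abs_summable_on UNIV"
proof -
  have "bij_betw (\<lambda>(m, l). (m + l, l)) UNIV (UNIV :: (int \<times> int) set)"
    by (rule bij_betw_byWitness[where f' = "\<lambda>(k, l). (k - l, l)"]) auto
  from summable_on_reindex_bij_betw[OF this, of "\<lambda>z. norm ((\<lambda>(k, l). f k * g l) z)"]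
  show ?thesis
    using abs_summable_times[OF assms] by (simp add: case_prod_unfold)
qed

section \<open>Correlations of convolution inverses are orthogonal\<close>

text \<open>If \<open>\<alpha>\<close> and \<open>\<beta>\<close> are the Fourier coefficients of \<open>1 / b\<close> and \<open>b\<close>, then the correlation below has
  Fourier series \<open>b / cnj b\<close> for real sequences, which has modulus one on the unit circle.
  That is why its integer translates are orthonormal; the proof uses convolution sums only.\<close>

locale inverse_sequences =
  fixes \<alpha> :: "nat \<Rightarrow> real" and \<beta> :: "int \<Rightarrow> real"
  assumes abs_summable_left: "\<alpha> abs_summable_on UNIV"
    and abs_summable_right: "\<beta> abs_summable_on UNIV"
    and inverse: "(\<Sum>\<^sub>\<infinity>i. \<alpha> i * \<beta> (N - int i)) = (if N = 0 then 1 else 0)"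
begin

definition correlation :: "int \<Rightarrow> real" where
  "correlation k = (\<Sum>\<^sub>\<infinity>i. \<alpha> i * \<beta> (k + int i))"

lemma abs_summable_correlation_terms:
  "(\<lambda>(k, i). \<alpha> i * \<beta> (k + int i)) abs_summable_on UNIV"
proof -
  have "(\<lambda>(i, k). \<alpha> i * \<beta> k) abs_summable_on UNIV \<times> UNIV"
    by (rule abs_summable_times[OF abs_summable_left abs_summable_right])
  moreover have "bij_betw (\<lambda>(k, i). (i, k + int i)) UNIV UNIV"
    by (rule bij_betw_byWitness[where f' = "\<lambda>(i, k). (k - int i, i)"]) auto
  ultimately show ?thesis
    using summable_on_reindex_bij_betw
        [of "\<lambda>(k, i). (i, k + int i)" UNIV UNIV "\<lambda>z. norm ((\<lambda>(i, k). \<alpha> i * \<beta> k) z)"]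
    by (simp add: case_prod_unfold)
qed

lemma abs_summable_correlation: "correlation abs_summable_on UNIV"
  unfolding correlation_def[abs_def]
  by (rule abs_summable_marginal[OF abs_summable_correlation_terms])

text \<open>Each of the two correlations is expanded, which gives a triple sum over \<open>k, i, j\<close>. Replacing \<open>k\<close>
  by \<open>N = k + n + i + j\<close> makes the summand split, for fixed \<open>N\<close>, into two convolutions of \<open>\<alpha>\<close> with
  \<open>\<beta>\<close>, which vanish unless \<open>N = 0\<close> and \<open>N + m - n = 0\<close>.\<close>

lemma correlation_orthogonal:
  "(\<Sum>\<^sub>\<infinity>k. correlation (k + n) * correlation (k + m)) = (if n = m then 1 else 0)"
proof -
  let ?B = "\<Sum>\<^sub>\<infinity>k. norm (\<beta> k)"
  let ?G = "\<lambda>N (i, j). (\<alpha> i * \<beta> (N + m - n - int i)) * (\<alpha> j * \<beta> (N - int j))"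
  let ?F = "\<lambda>k (i, j). (\<alpha> i * \<beta> (k + n + int i)) * (\<alpha> j * \<beta> (k + m + int j))"
  have \<beta>_le: "norm (\<beta> k) \<le> ?B" for k
    by (rule abs_summable_bounded[OF abs_summable_right])
  have summable_left: "(\<lambda>i. \<alpha> i * \<beta> (h i)) abs_summable_on UNIV" for h
    by (rule abs_summable_mult_bounded[OF abs_summable_left \<beta>_le])
  have pairs: "(\<Sum>\<^sub>\<infinity>(i, j). (\<alpha> i * \<beta> (h i)) * (\<alpha> j * \<beta> (h' j))) =
      (\<Sum>\<^sub>\<infinity>i. \<alpha> i * \<beta> (h i)) * (\<Sum>\<^sub>\<infinity>j. \<alpha> j * \<beta> (h' j))" for h h'
    by (rule infsum_times[OF summable_left summable_left])
  have G: "(\<lambda>(N, z). ?G N z) abs_summable_on UNIV"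
  proof -
    have "(\<lambda>((i, j), k). (\<alpha> i * \<alpha> j) * \<beta> k) abs_summable_on (UNIV \<times> UNIV) \<times> UNIV"
      using abs_summable_times[OF abs_summable_times[OF abs_summable_left abs_summable_left]
          abs_summable_right]
      by (simp add: case_prod_unfold)
    moreover have "bij_betw (\<lambda>(N, i, j). ((i, j), N - int j)) UNIV UNIV"
      by (rule bij_betw_byWitness[where f' = "\<lambda>((i, j), k). (k + int j, i, j)"]) auto
    ultimately have "(\<lambda>(N, i, j). (\<alpha> i * \<alpha> j) * \<beta> (N - int j)) abs_summable_on UNIV"
      using summable_on_reindex_bij_betw[of "\<lambda>(N, i, j). ((i, j), N - int j)" UNIV UNIV
          "\<lambda>z. norm ((\<lambda>((i, j), k). (\<alpha> i * \<alpha> j) * \<beta> k) z)"]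
      by (simp add: case_prod_unfold)
    from abs_summable_mult_bounded[OF this, of "\<lambda>(N, i, j). \<beta> (N + m - n - int i)" ?B]
    show ?thesis
      using \<beta>_le by (simp add: case_prod_unfold mult_ac)
  qed
  have bij: "bij_betw (\<lambda>(k, i, j). (k + n + int i + int j, i, j)) UNIV UNIV"
    by (rule bij_betw_byWitness[where f' = "\<lambda>(N, i, j). (N - n - int i - int j, i, j)"]) auto
  have FG: "(\<lambda>(k, z). ?F k z) = (\<lambda>z. (\<lambda>(N, z). ?G N z) ((\<lambda>(k, i, j). (k + n + int i + int j, i, j)) z))"
    by (auto simp: fun_eq_iff algebra_simps)
  have F: "(\<lambda>(k, z). ?F k z) abs_summable_on UNIV"
    unfolding FG using G
    summable_on_reindex_bij_betw[OF bij, of "\<lambda>z. norm ((\<lambda>(N, z). ?G N z) z)"] by simp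
  have "(\<Sum>\<^sub>\<infinity>k. correlation (k + n) * correlation (k + m)) = (\<Sum>\<^sub>\<infinity>k. \<Sum>\<^sub>\<infinity>z. ?F k z)"
    unfolding correlation_def pairs[symmetric] ..
  also have "\<dots> = (\<Sum>\<^sub>\<infinity>(k, z). ?F k z)"
    using infsum_Sigma'_banach[of ?F UNIV "\<lambda>_. UNIV"] abs_summable_summable[OF F] by simp
  also have "\<dots> = (\<Sum>\<^sub>\<infinity>(N, z). ?G N z)"
    unfolding FG by (rule infsum_reindex_bij_betw[OF bij])
  also have "\<dots> = (\<Sum>\<^sub>\<infinity>N. \<Sum>\<^sub>\<infinity>z. ?G N z)"
    using infsum_Sigma'_banach[of ?G UNIV "\<lambda>_. UNIV"] abs_summable_summable[OF G] by simp
  also have "\<dots> = (\<Sum>\<^sub>\<infinity>N. (\<Sum>\<^sub>\<infinity>i. \<alpha> i * \<beta> (N + m - n - int i)) * (\<Sum>\<^sub>\<infinity>j. \<alpha> j * \<beta> (N - int j)))"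
    unfolding pairs ..
  also have "\<dots> = (\<Sum>\<^sub>\<infinity>N::int. if N = 0 then (if n = m then 1 else 0) else 0)"
    unfolding inverse by (intro infsum_cong) auto
  also have "\<dots> = (if n = m then 1 else 0)"
    by (subst infsum_cong_neutral[where T = "{0::int}" and g = "\<lambda>_. if n = m then 1 else 0"]) auto
  finally show ?thesis .
qed

end

section \<open>Square summable sequences\<close>

definition square_summable :: "('a \<Rightarrow> complex) \<Rightarrow> bool" where
  "square_summable x \<longleftrightarrow> (\<lambda>k. (cmod (x k))\<^sup>2) summable_on UNIV"

lemma square_summable_bounded:
  assumes "square_summable x"
  obtains B where "\<And>k. cmod (x k) \<le> B"
proof
  fix k
  have "(cmod (x k))\<^sup>2 \<le> (\<Sum>\<^sub>\<infinity>l. (cmod (x l))\<^sup>2)"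
    using finite_sum_le_infsum[of "\<lambda>l. (cmod (x l))\<^sup>2" UNIV "{k}"] assms
    by (simp add: square_summable_def)
  then show "cmod (x k) \<le> sqrt (\<Sum>\<^sub>\<infinity>l. (cmod (x l))\<^sup>2)"
    by (rule real_le_rsqrt)
qed

lemma square_summable_cnj: "square_summable x \<Longrightarrow> square_summable (\<lambda>k. cnj (x k))"
  by (simp add: square_summable_def)

lemma square_summable_shift:
  fixes x :: "int \<Rightarrow> complex"
  assumes "square_summable x"
  shows "square_summable (\<lambda>k. x (n + k))"
  using assms summable_shift_int[of "\<lambda>k. (cmod (x k))\<^sup>2" n]
  by (simp add: square_summable_def add.commute)

lemma square_summable_mult_bounded:
  assumes "square_summable x" and "\<And>k. cmod (c k) \<le> B"
  shows "square_summable (\<lambda>k. c k * x k)"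
  unfolding square_summable_def
proof (rule summable_on_comparison_test)
  show "(\<lambda>k. B\<^sup>2 * (cmod (x k))\<^sup>2) summable_on UNIV"
    using assms(1) unfolding square_summable_def by (rule summable_on_cmult_right)
  show "(cmod (c k * x k))\<^sup>2 \<le> B\<^sup>2 * (cmod (x k))\<^sup>2" for k
    unfolding norm_mult power_mult_distrib
    by (intro mult_right_mono power_mono assms(2)) simp_all
qed simp

lemma square_summable_cmult: "square_summable x \<Longrightarrow> square_summable (\<lambda>k. c * x k)"
  by (rule square_summable_mult_bounded[where B = "cmod c"]) simp_all

section \<open>Unitary Hankel operators\<close>

text \<open>The matrix \<open>v (n + k)\<close> is real and symmetric, so orthonormality of its columns makes it an
  involution. Absolute summability of the kernel justifies all rearrangements directly.\<close>

locale unitary_hankel =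
  fixes v :: "int \<Rightarrow> real"
  assumes abs_summable_kernel: "v abs_summable_on UNIV"
    and orthogonal: "(\<Sum>\<^sub>\<infinity>k. v (k + n) * v (k + m)) = (if n = m then 1 else 0)"
begin

definition hankel :: "(int \<Rightarrow> complex) \<Rightarrow> int \<Rightarrow> complex" where
  "hankel x n = (\<Sum>\<^sub>\<infinity>k. of_real (v (n + k)) * x k)"

lemma abs_summable_complex_kernel: "(\<lambda>k. complex_of_real (v k)) abs_summable_on UNIV"
  using abs_summable_kernel by simp

lemma abs_summable_shifted_kernel: "(\<lambda>k. complex_of_real (v (n + k))) abs_summable_on UNIV"
  using abs_summable_kernel summable_shift_int[of "\<lambda>k. norm (v k)" n] by (simp add: add.commute)

lemma kernel_bounded: "cmod (of_real (v k)) \<le> (\<Sum>\<^sub>\<infinity>l. norm (v l))"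
  using abs_summable_bounded[OF abs_summable_kernel] by simp

lemma square_summable_kernel: "square_summable (\<lambda>k. of_real (v (n + k)))"
  using abs_summable_mult_bounded[OF abs_summable_shifted_kernel[of n],
      where g = "\<lambda>k. of_real (v (n + k))", OF kernel_bounded]
  by (simp add: square_summable_def norm_mult power2_eq_square)

lemma orthogonal_complex:
  "(\<Sum>\<^sub>\<infinity>k. complex_of_real (v (k + n)) * of_real (v (k + m))) = (if n = m then 1 else 0)"
  using arg_cong[OF orthogonal[of n m], of complex_of_real]
  by (simp flip: infsum_of_real of_real_mult)

lemma abs_summable_hankel_terms:
  assumes "\<And>k. cmod (x k) \<le> B"
  shows "(\<lambda>k. of_real (v (n + k)) * x k) abs_summable_on UNIV"
  by (rule abs_summable_mult_bounded[OF abs_summable_shifted_kernel assms])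

lemma hankel_cmult: "hankel (\<lambda>k. c * x k) n = c * hankel x n"
  unfolding hankel_def by (subst infsum_cmult_right'[symmetric]) (simp add: mult_ac)

lemma hankel_cnj: "hankel (\<lambda>k. cnj (x k)) n = cnj (hankel x n)"
  unfolding hankel_def by (simp flip: infsum_cnj)

text \<open>An absolutely summable kernel pairs with bounded sequences, so the double sum behind
  \<open>hankel (hankel x)\<close> may be exchanged; orthogonality then leaves the term at \<open>n\<close>.\<close>

lemma hankel_involution:
  assumes "\<And>k. cmod (x k) \<le> B"
  shows "hankel (hankel x) n = x n"
proof -
  have "(\<lambda>(m, k). complex_of_real (v (m + k)) * of_real (v (n + k))) abs_summable_on UNIV"
    by (rule abs_summable_shifted_times[OF abs_summable_complex_kernel abs_summable_shifted_kernel])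
  from abs_summable_mult_bounded[OF this, of "\<lambda>(m, k). x m" B]
  have *: "(\<lambda>(m, k). of_real (v (n + k)) * (of_real (v (k + m)) * x m)) abs_summable_on UNIV"
    using assms by (simp add: case_prod_unfold mult_ac add.commute)
  have "hankel (hankel x) n = (\<Sum>\<^sub>\<infinity>k. \<Sum>\<^sub>\<infinity>m. of_real (v (n + k)) * (of_real (v (k + m)) * x m))"
    unfolding hankel_def by (simp only: infsum_cmult_right')
  also have "\<dots> = (\<Sum>\<^sub>\<infinity>m. \<Sum>\<^sub>\<infinity>k. of_real (v (n + k)) * (of_real (v (k + m)) * x m))"
    by (rule infsum_swap_abs[OF *, symmetric])
  also have "\<dots> = (\<Sum>\<^sub>\<infinity>m. (\<Sum>\<^sub>\<infinity>k. of_real (v (k + n)) * of_real (v (k + m))) * x m)"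
    by (subst infsum_cmult_left'[symmetric]) (simp add: mult_ac add.commute)
  also have "\<dots> = (\<Sum>\<^sub>\<infinity>m. if m = n then x n else 0)"
    unfolding orthogonal_complex by (intro infsum_cong) auto
  also have "\<dots> = x n"
    by (subst infsum_cong_neutral[where T = "{n}" and g = "\<lambda>_. x n"]) auto
  finally show ?thesis .
qed

text \<open>By \<open>2 a b \<le> a\<^sup>2 + b\<^sup>2\<close> the product \<open>|x k| |y l|\<close> splits into a part that depends on \<open>k\<close> alone and
  one that depends on \<open>l\<close> alone. In each part the three factors have independent arguments after a
  change of variables.\<close>

lemma abs_summable_parseval_terms:
  assumes "square_summable x" and "square_summable y"
  shows "(\<lambda>(n, k, l). (of_real (v (n + k)) * x k) * (of_real (v (n + l)) * y l)) abs_summable_on UNIV"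
proof -
  have *: "(\<lambda>((i, j), k). (v i * v j) * (cmod (z k))\<^sup>2) abs_summable_on UNIV"
    if "square_summable z" for z :: "int \<Rightarrow> complex"
  proof -
    have "(\<lambda>k. (cmod (z k))\<^sup>2) abs_summable_on UNIV"
      using that by (simp add: square_summable_def)
    from abs_summable_times[OF abs_summable_times[OF abs_summable_kernel abs_summable_kernel] this]
    show ?thesis by (simp add: case_prod_unfold)
  qed
  have "bij_betw (\<lambda>(n, k, l). ((n + k, n + l), k)) UNIV (UNIV :: ((int \<times> int) \<times> int) set)"
    by (rule bij_betw_byWitness[where f' = "\<lambda>((i, j), k). (i - k, k, j + k - i)"]) auto
  from summable_on_reindex_bij_betw[OF this,
      of "\<lambda>z. norm ((\<lambda>((i, j), k). (v i * v j) * (cmod (x k))\<^sup>2) z)"]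
  have 1: "(\<lambda>(n, k, l). \<bar>v (n + k)\<bar> * \<bar>v (n + l)\<bar> * (cmod (x k))\<^sup>2) summable_on UNIV"
    using *[OF assms(1)] by (simp add: case_prod_unfold abs_mult)
  have "bij_betw (\<lambda>(n, k, l). ((n + k, n + l), l)) UNIV (UNIV :: ((int \<times> int) \<times> int) set)"
    by (rule bij_betw_byWitness[where f' = "\<lambda>((i, j), l). (j - l, i + l - j, l)"]) auto
  from summable_on_reindex_bij_betw[OF this,
      of "\<lambda>z. norm ((\<lambda>((i, j), k). (v i * v j) * (cmod (y k))\<^sup>2) z)"]
  have 2: "(\<lambda>(n, k, l). \<bar>v (n + k)\<bar> * \<bar>v (n + l)\<bar> * (cmod (y l))\<^sup>2) summable_on UNIV"
    using *[OF assms(2)] by (simp add: case_prod_unfold abs_mult)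
  show ?thesis
  proof (rule Infinite_Sum.abs_summable_on_comparison_test'[OF summable_on_add[OF 1 2]])
    fix z :: "int \<times> int \<times> int"
    obtain n k l where z: "z = (n, k, l)" by (cases z)
    have "cmod (x k) * cmod (y l) \<le> (cmod (x k))\<^sup>2 + (cmod (y l))\<^sup>2"
      using sum_squares_bound[of "cmod (x k)" "cmod (y l)"]
        mult_nonneg_nonneg[OF norm_ge_zero norm_ge_zero, of "x k" "y l"] by linarith
    from mult_left_mono[OF this, of "\<bar>v (n + k)\<bar> * \<bar>v (n + l)\<bar>"]
    show "norm (case z of (n, k, l) \<Rightarrow> (of_real (v (n + k)) * x k) * (of_real (v (n + l)) * y l))
        \<le> (case z of (n, k, l) \<Rightarrow> \<bar>v (n + k)\<bar> * \<bar>v (n + l)\<bar> * (cmod (x k))\<^sup>2) +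
          (case z of (n, k, l) \<Rightarrow> \<bar>v (n + k)\<bar> * \<bar>v (n + l)\<bar> * (cmod (y l))\<^sup>2)"
      by (simp add: z norm_mult algebra_simps)
  qed
qed

lemma hankel_times:
  assumes "square_summable x" and "square_summable y"
  shows "hankel x n * hankel y n =
    (\<Sum>\<^sub>\<infinity>(k, l). (of_real (v (n + k)) * x k) * (of_real (v (n + l)) * y l))"
proof -
  from square_summable_bounded[OF assms(1)] obtain A where "\<And>k. cmod (x k) \<le> A" by blast
  moreover from square_summable_bounded[OF assms(2)] obtain B where "\<And>k. cmod (y k) \<le> B" by blast
  ultimately show ?thesis
    unfolding hankel_def by (intro infsum_times[symmetric] abs_summable_hankel_terms)
qed

text \<open>Proved for the bilinear pairing without conjugation, which is natural for a real symmetric matrix;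
  the Hermitian version follows by inserting \<open>cnj\<close> into one argument.\<close>

lemma hankel_parseval:
  assumes x: "square_summable x" and y: "square_summable y"
  shows "(\<Sum>\<^sub>\<infinity>n. hankel x n * hankel y n) = (\<Sum>\<^sub>\<infinity>k. x k * y k)"
proof -
  let ?t = "\<lambda>n (k, l). (of_real (v (n + k)) * x k) * (of_real (v (n + l)) * y l)"
  have t: "(\<lambda>(n, z). ?t n z) abs_summable_on UNIV"
    by (rule abs_summable_parseval_terms[OF assms])
  have inner: "(\<Sum>\<^sub>\<infinity>n. ?t n z) = (case z of (k, l) \<Rightarrow> if k = l then x k * y k else 0)" for z
  proof -
    obtain k l where z: "z = (k, l)" by (cases z)
    have "(\<Sum>\<^sub>\<infinity>n. ?t n z) =
        (x k * y l) * (\<Sum>\<^sub>\<infinity>n. complex_of_real (v (n + k)) * of_real (v (n + l)))"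
      by (subst infsum_cmult_right'[symmetric]) (simp add: z mult_ac)
    then show ?thesis
      unfolding orthogonal_complex by (simp add: z)
  qed
  have diag: "(\<Sum>\<^sub>\<infinity>(k, l). if k = l then x k * y k else 0) = (\<Sum>\<^sub>\<infinity>k. x k * y k)"
  proof -
    have "(\<Sum>\<^sub>\<infinity>(k, l). if k = l then x k * y k else 0) =
        (\<Sum>\<^sub>\<infinity>(k, l) \<in> range (\<lambda>k. (k, k)). x k * y k)"
      by (intro infsum_cong_neutral) auto
    also have "\<dots> = (\<Sum>\<^sub>\<infinity>k. x k * y k)"
      by (subst infsum_reindex) (auto simp: inj_on_def o_def)
    finally show ?thesis .
  qed
  have "(\<Sum>\<^sub>\<infinity>n. hankel x n * hankel y n) = (\<Sum>\<^sub>\<infinity>n. \<Sum>\<^sub>\<infinity>z. ?t n z)"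
    by (simp only: hankel_times[OF assms])
  also have "\<dots> = (\<Sum>\<^sub>\<infinity>z. \<Sum>\<^sub>\<infinity>n. ?t n z)"
    by (rule infsum_swap_abs[OF t])
  also have "\<dots> = (\<Sum>\<^sub>\<infinity>k. x k * y k)"
    unfolding inner diag ..
  finally show ?thesis .
qed

lemma square_summable_hankel:
  assumes "square_summable x"
  shows "square_summable (hankel x)"
proof -
  have "(\<lambda>n. hankel x n * hankel (\<lambda>k. cnj (x k)) n) abs_summable_on UNIV"
    unfolding hankel_times[OF assms square_summable_cnj[OF assms]]
    by (rule abs_summable_marginal[OF abs_summable_parseval_terms[OF assms square_summable_cnj[OF assms]]])
  then show ?thesis
    by (simp add: square_summable_def hankel_cnj norm_mult power2_eq_square)
qed

lemma hankel_norm: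
  assumes "square_summable x"
  shows "(\<Sum>\<^sub>\<infinity>n. (cmod (hankel x n))\<^sup>2) = (\<Sum>\<^sub>\<infinity>k. (cmod (x k))\<^sup>2)"
proof -
  have "complex_of_real (\<Sum>\<^sub>\<infinity>n. (cmod (hankel x n))\<^sup>2) = (\<Sum>\<^sub>\<infinity>n. hankel x n * hankel (\<lambda>k. cnj (x k)) n)"
    unfolding hankel_cnj complex_norm_square[symmetric] infsum_of_real[symmetric] ..
  also have "\<dots> = (\<Sum>\<^sub>\<infinity>k. x k * cnj (x k))"
    by (rule hankel_parseval[OF assms square_summable_cnj[OF assms]])
  also have "\<dots> = complex_of_real (\<Sum>\<^sub>\<infinity>k. (cmod (x k))\<^sup>2)"
    unfolding complex_norm_square[symmetric] infsum_of_real[symmetric] ..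
  finally show ?thesis
    by (simp only: of_real_eq_iff)
qed

text \<open>Unitarity turns the sum over \<open>k\<close> into a sum of \<open>|w (m + l)|\<^sup>2 |z l|\<^sup>2\<close> over \<open>l\<close>, and this is
  summable over all pairs \<open>(m, l)\<close>.\<close>

lemma summable_hankel_shifted:
  assumes z: "square_summable z" and w: "square_summable w"
    and P: "\<And>m l. cmod (P m l) = cmod (w (m + l)) * cmod (z l)"
  shows "(\<lambda>(m, k). (cmod (hankel (P m) k))\<^sup>2) summable_on UNIV"
proof -
  from square_summable_bounded[OF w] obtain B where B: "\<And>k. cmod (w k) \<le> B" by blast
  have P_square: "square_summable (P m)" for m
    using square_summable_mult_bounded[OF z, of "\<lambda>l. w (m + l)" B] B
    by (simp add: square_summable_def P norm_mult)
  have "(\<lambda>k. (cmod (w k))\<^sup>2) abs_summable_on UNIV" "(\<lambda>k. (cmod (z k))\<^sup>2) abs_summable_on UNIV"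
    using z w by (simp_all add: square_summable_def)
  from abs_summable_marginal[OF abs_summable_shifted_times[OF this]]
  have "(\<lambda>m. \<Sum>\<^sub>\<infinity>l. (cmod (P m l))\<^sup>2) abs_summable_on UNIV"
    by (simp add: P power_mult_distrib)
  then have "(\<lambda>m. \<Sum>\<^sub>\<infinity>k. (cmod (hankel (P m) k))\<^sup>2) abs_summable_on UNIV"
    unfolding hankel_norm[OF P_square] .
  moreover have "(\<lambda>k. (cmod (hankel (P m) k))\<^sup>2) summable_on UNIV" for m
    using square_summable_hankel[OF P_square] by (simp add: square_summable_def)
  ultimately have "(\<lambda>(m, k). (cmod (hankel (P m) k))\<^sup>2) abs_summable_on UNIV \<times> UNIV"
    by (subst Infinite_Sum.abs_summable_on_Sigma_iff) simp
  then show ?thesis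
    by (simp add: case_prod_unfold)
qed

text \<open>The reconstruction formula in terms of sequences: \<open>m\<close> is the exponent of the dilation, \<open>k\<close> that of
  the translation. Absolute convergence holds because the two factors of \<open>T\<close> are square
  summable over all pairs \<open>(m, k)\<close>. For the value, Parseval in \<open>k\<close> leaves
  \<open>hankel x l * v (n + l) * |\<gamma> (m + l)|\<^sup>2\<close>, whose sum over \<open>m\<close> separates by translation invariance,
  and the remaining sum over \<open>l\<close> is \<open>hankel (hankel x) n\<close>.\<close>

lemma
  fixes n :: int
  assumes x: "square_summable x" and \<gamma>: "square_summable \<gamma>"
  defines "T \<equiv> \<lambda>m k. hankel (\<lambda>l. hankel x l * cnj (\<gamma> (m + l))) k *
                     hankel (\<lambda>l. of_real (v (n + l)) * \<gamma> (m + l)) k"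
  shows abs_summable_discrete_reconstruction: "(\<lambda>(m, k). T m k) abs_summable_on UNIV"
    and discrete_reconstruction:
      "(\<Sum>\<^sub>\<infinity>(m, k). T m k) = of_real (\<Sum>\<^sub>\<infinity>l. (cmod (\<gamma> l))\<^sup>2) * x n"
proof -
  let ?P = "\<lambda>m l. hankel x l * cnj (\<gamma> (m + l))"
  let ?Q = "\<lambda>m l. of_real (v (n + l)) * \<gamma> (m + l)"
  have F: "square_summable (hankel x)"
    by (rule square_summable_hankel[OF x])
  from square_summable_bounded[OF F] obtain A where A: "\<And>l. cmod (hankel x l) \<le> A" by blast
  from square_summable_bounded[OF x] obtain X where X: "\<And>l. cmod (x l) \<le> X" by blast
  have P: "square_summable (?P m)" for m
    by (rule square_summable_mult_bounded[OF square_summable_cnj[OF square_summable_shift[OF \<gamma>]] A])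
  have Q: "square_summable (?Q m)" for m
    by (rule square_summable_mult_bounded[OF square_summable_shift[OF \<gamma>] kernel_bounded])
  show T: "(\<lambda>(m, k). T m k) abs_summable_on UNIV"
  proof (rule Infinite_Sum.abs_summable_on_comparison_test')
    show "(\<lambda>z. (case z of (m, k) \<Rightarrow> (cmod (hankel (?P m) k))\<^sup>2) +
        (case z of (m, k) \<Rightarrow> (cmod (hankel (?Q m) k))\<^sup>2)) summable_on UNIV"
      by (intro summable_on_add summable_hankel_shifted[OF F \<gamma>]
          summable_hankel_shifted[OF square_summable_kernel[of n] \<gamma>])
         (simp_all add: norm_mult)
    fix z :: "int \<times> int"
    obtain m k where z: "z = (m, k)" by (cases z)
    have "a * b \<le> a\<^sup>2 + b\<^sup>2" if "0 \<le> a" "0 \<le> b" for a b :: real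
      using sum_squares_bound[of a b] mult_nonneg_nonneg[OF that] by linarith
    then show "norm (case z of (m, k) \<Rightarrow> T m k) \<le> (case z of (m, k) \<Rightarrow> (cmod (hankel (?P m) k))\<^sup>2) +
        (case z of (m, k) \<Rightarrow> (cmod (hankel (?Q m) k))\<^sup>2)"
      by (simp add: z T_def norm_mult)
  qed
  have PQ: "(\<lambda>(m, l). ?P m l * ?Q m l) abs_summable_on UNIV"
  proof -
    have "(\<lambda>k. complex_of_real ((cmod (\<gamma> k))\<^sup>2)) abs_summable_on UNIV"
      using \<gamma> by (simp add: square_summable_def norm_power)
    \<comment> \<open>the square of \<open>\<gamma>\<close> is summable and \<open>v (n + l) * hankel x l\<close> is absolutely summable in \<open>l\<close>\<close>
    from abs_summable_shifted_times[OF this abs_summable_hankel_terms[where x = "hankel x", OF A, of n]]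
    show ?thesis
      by (simp only: complex_norm_square mult_ac)
  qed
  have "(\<Sum>\<^sub>\<infinity>(m, k). T m k) = (\<Sum>\<^sub>\<infinity>m. \<Sum>\<^sub>\<infinity>k. T m k)"
    using infsum_Sigma'_banach[of T UNIV "\<lambda>_. UNIV"] abs_summable_summable[OF T] by simp
  also have "\<dots> = (\<Sum>\<^sub>\<infinity>m. \<Sum>\<^sub>\<infinity>l. ?P m l * ?Q m l)"
    unfolding T_def by (simp only: hankel_parseval[OF P Q])
  also have "\<dots> = (\<Sum>\<^sub>\<infinity>l. \<Sum>\<^sub>\<infinity>m. ?P m l * ?Q m l)"
    by (rule infsum_swap_abs[OF PQ])
  also have "\<dots> = (\<Sum>\<^sub>\<infinity>l. of_real (\<Sum>\<^sub>\<infinity>m. (cmod (\<gamma> m))\<^sup>2) * (of_real (v (n + l)) * hankel x l))"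
  proof (rule infsum_cong)
    fix l
    have "(\<Sum>\<^sub>\<infinity>m. ?P m l * ?Q m l) =
        (\<Sum>\<^sub>\<infinity>m. complex_of_real ((cmod (\<gamma> (m + l)))\<^sup>2) * (of_real (v (n + l)) * hankel x l))"
      by (simp only: complex_norm_square mult_ac)
    also have "\<dots> = (\<Sum>\<^sub>\<infinity>m. complex_of_real ((cmod (\<gamma> (m + l)))\<^sup>2)) * (of_real (v (n + l)) * hankel x l)"
      by (rule infsum_cmult_left')
    also have "(\<Sum>\<^sub>\<infinity>m. complex_of_real ((cmod (\<gamma> (m + l)))\<^sup>2)) = of_real (\<Sum>\<^sub>\<infinity>m. (cmod (\<gamma> m))\<^sup>2)"
      unfolding infsum_of_real by (simp only: infsum_shift_int[of "\<lambda>m. (cmod (\<gamma> m))\<^sup>2" l])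
    finally show "(\<Sum>\<^sub>\<infinity>m. ?P m l * ?Q m l) =
        of_real (\<Sum>\<^sub>\<infinity>m. (cmod (\<gamma> m))\<^sup>2) * (of_real (v (n + l)) * hankel x l)" .
  qed
  also have "\<dots> = of_real (\<Sum>\<^sub>\<infinity>m. (cmod (\<gamma> m))\<^sup>2) * hankel (hankel x) n"
    unfolding hankel_def[of "hankel x"] by (rule infsum_cmult_right')
  also have "hankel (hankel x) n = x n"
    by (rule hankel_involution[OF X])
  finally show "(\<Sum>\<^sub>\<infinity>(m, k). T m k) = of_real (\<Sum>\<^sub>\<infinity>l. (cmod (\<gamma> l))\<^sup>2) * x n" .
qed

end

section \<open>The Euler series and its reciprocal\<close>

lemma qpoch_0 [simp]: "qpoch a p 0 = 1"
  by (simp add: qpoch_def)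

lemma qpoch_Suc: "qpoch a p (Suc n) = qpoch a p n * (1 - a * p ^ n)"
  by (simp add: qpoch_def)

lemma powi_inject:
  fixes q :: real
  assumes "0 < q" and "q < 1"
  shows "q powi m = q powi n \<longleftrightarrow> m = n"
  using assms powr_inj[of q "of_int m" "of_int n"] by (simp add: powr_real_of_int')

locale q_series =
  fixes p :: real
  assumes p_pos: "0 < p" and p_less_1: "p < 1"
begin

lemma factor_pos:
  assumes "0 \<le> a" and "a < 1"
  shows "0 < 1 - a * p ^ n"
proof -
  have "a * p ^ n \<le> a * 1"
    using assms p_pos p_less_1 by (intro mult_left_mono power_le_one) auto
  then show ?thesis using assms by simp
qed

lemma qpoch_pos: "0 \<le> a \<Longrightarrow> a < 1 \<Longrightarrow> 0 < qpoch a p n"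
  by (simp add: qpoch_def factor_pos prod_pos del: diff_gt_0_iff_gt)

text \<open>These are the coefficients in Euler's expansion of \<open>(w;p)\<^sub>\<infinity>\<close>, so \<open>euler_fun w\<close> below is that
  infinite product, and \<open>euler_fun_rec\<close> splits off its first factor.\<close>

definition euler_coeff :: "nat \<Rightarrow> real" where
  "euler_coeff n = (- 1) ^ n * p ^ (n choose 2) / qpoch p p n"

definition euler_fun :: "real \<Rightarrow> real" where
  "euler_fun w = (\<Sum>\<^sub>\<infinity>n. euler_coeff n * w ^ n)"

lemma euler_coeff_0 [simp]: "euler_coeff 0 = 1"
  by (simp add: euler_coeff_def numeral_2_eq_2)

lemma euler_coeff_Suc: "euler_coeff (Suc n) * (1 - p ^ Suc n) = - (p ^ n) * euler_coeff n"
proof -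
  have "1 - p ^ Suc n \<noteq> 0" "qpoch p p n \<noteq> 0"
    using factor_pos[of p n] qpoch_pos[of p n] p_pos p_less_1 by auto
  then show ?thesis
    by (simp add: euler_coeff_def qpoch_Suc numeral_2_eq_2 power_add)
qed

lemma abs_summable_euler: "(\<lambda>n. euler_coeff n * w ^ n) abs_summable_on UNIV"
proof -
  \<comment> \<open>from this index on the ratio of consecutive terms, at most \<open>p ^ n * \<bar>w\<bar> / (1 - p)\<close>, is below one half\<close>
  obtain N where N: "p ^ N < (1 - p) / (2 * (\<bar>w\<bar> + 1))"
    using real_arch_pow_inv[of "(1 - p) / (2 * (\<bar>w\<bar> + 1))" p] p_less_1 by auto
  have "summable (\<lambda>n. norm (euler_coeff n * w ^ n))"
  proof (rule summable_ratio_test[where c = "1 / 2" and N = N])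
    fix n assume "N \<le> n"
    have "p ^ n \<le> p ^ N"
      using \<open>N \<le> n\<close> p_pos p_less_1 by (intro power_decreasing) auto
    with N have "p ^ n < (1 - p) / (2 * (\<bar>w\<bar> + 1))"
      by linarith
    then have "p ^ n * (\<bar>w\<bar> + 1) < (1 - p) / 2"
      by (simp add: field_simps)
    moreover have "p ^ n * \<bar>w\<bar> \<le> p ^ n * (\<bar>w\<bar> + 1)"
      using p_pos by (intro mult_left_mono) auto
    moreover have "(1 - p) / 2 \<le> (1 - p ^ Suc n) / 2"
      using p_pos p_less_1 power_decreasing[of 1 "Suc n" p] by simp
    ultimately have "p ^ n * \<bar>w\<bar> \<le> (1 - p ^ Suc n) / 2"
      by linarith
    moreover have pos: "0 < 1 - p ^ Suc n"
      using factor_pos[of p n] p_pos p_less_1 by simp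
    ultimately have le: "p ^ n * \<bar>w\<bar> / (1 - p ^ Suc n) \<le> 1 / 2"
      by (simp add: field_simps)
    have "euler_coeff (Suc n) = - (p ^ n) * euler_coeff n / (1 - p ^ Suc n)"
      using euler_coeff_Suc[of n] pos by (simp add: field_simps)
    then have "norm (norm (euler_coeff (Suc n) * w ^ Suc n)) =
        (p ^ n * \<bar>w\<bar> / (1 - p ^ Suc n)) * norm (euler_coeff n * w ^ n)"
      using pos p_pos by (simp add: abs_mult power_abs)
    also have "\<dots> \<le> 1 / 2 * norm (euler_coeff n * w ^ n)"
      using le by (rule mult_right_mono) simp
    finally show "norm (norm (euler_coeff (Suc n) * w ^ Suc n)) \<le>
        1 / 2 * norm (norm (euler_coeff n * w ^ n))"
      by simp
  qed simp
  then show ?thesis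
    by (intro norm_summable_imp_summable_on) simp
qed

lemma euler_sums: "(\<lambda>n. euler_coeff n * w ^ n) sums euler_fun w"
  unfolding euler_fun_def
  by (rule has_sum_imp_sums[OF has_sum_infsum[OF abs_summable_summable[OF abs_summable_euler]]])

lemma euler_fun_rec: "euler_fun w = (1 - w) * euler_fun (p * w)"
proof -
  have "(\<lambda>n. euler_coeff n * w ^ n - euler_coeff n * (p * w) ^ n) sums
      (euler_fun w - euler_fun (p * w))"
    by (intro sums_diff euler_sums)
  moreover have "(\<lambda>n. euler_coeff n * w ^ n - euler_coeff n * (p * w) ^ n) sums
      (- w * euler_fun (p * w))"
  proof -
    have "euler_coeff (Suc n) * w ^ Suc n - euler_coeff (Suc n) * (p * w) ^ Suc n =
        - w * (euler_coeff n * (p * w) ^ n)" for n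
    proof -
      have "euler_coeff (Suc n) * w ^ Suc n - euler_coeff (Suc n) * (p * w) ^ Suc n =
          (euler_coeff (Suc n) * (1 - p ^ Suc n)) * w ^ Suc n"
        unfolding power_mult_distrib by (simp only: algebra_simps)
      then show ?thesis
        unfolding euler_coeff_Suc by (simp add: power_mult_distrib)
    qed
    then have "(\<lambda>n. euler_coeff (Suc n) * w ^ Suc n - euler_coeff (Suc n) * (p * w) ^ Suc n) sums
        (- w * euler_fun (p * w))"
      by (simp only: sums_mult[OF euler_sums])
    then show ?thesis
      by (subst (asm) sums_Suc_iff) simp
  qed
  ultimately have "euler_fun w - euler_fun (p * w) = - w * euler_fun (p * w)"
    by (rule sums_unique2)
  then show ?thesis
    unfolding left_diff_distrib by linarith
qed

lemma euler_fun_shift: "euler_fun w = qpoch w p n * euler_fun (w * p ^ n)"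
proof (induction n)
  case (Suc n)
  have "p * (w * p ^ n) = w * p ^ Suc n"
    by simp
  then have "euler_fun (w * p ^ n) = (1 - w * p ^ n) * euler_fun (w * p ^ Suc n)"
    using euler_fun_rec[of "w * p ^ n"] by metis
  have "euler_fun w = qpoch w p n * euler_fun (w * p ^ n)"
    by (rule Suc.IH)
  also have "\<dots> = qpoch w p (Suc n) * euler_fun (w * p ^ Suc n)"
    unfolding qpoch_Suc mult.assoc \<open>euler_fun (w * p ^ n) = _\<close> ..
  finally show ?case .
qed simp

lemma euler_fun_pos:
  assumes "0 < w" and "w < 1"
  shows "0 < euler_fun w"
proof -
  have "(euler_fun \<longlongrightarrow> euler_coeff 0) (at 0)"
    by (rule powser_limit_0[of 1]) (simp_all add: euler_sums)
  moreover have "filterlim (\<lambda>n. w * p ^ n) (at 0) sequentially"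
  proof (rule filterlim_atI)
    show "(\<lambda>n. w * p ^ n) \<longlonglongrightarrow> 0"
      using tendsto_mult_right_zero[OF LIMSEQ_power_zero[of p], of w] p_pos p_less_1 by simp
    show "\<forall>\<^sub>F n in sequentially. w * p ^ n \<noteq> 0"
      using assms p_pos by simp
  qed
  ultimately have "(\<lambda>n. euler_fun (w * p ^ n)) \<longlonglongrightarrow> 1"
    using filterlim_compose[of euler_fun] by fastforce
  then have "\<forall>\<^sub>F n in sequentially. 0 < euler_fun (w * p ^ n)"
    by (rule order_tendstoD) simp
  then obtain n where "0 < euler_fun (w * p ^ n)"
    by (auto simp: eventually_sequentially)
  then show ?thesis
    using euler_fun_shift[of w n] qpoch_pos[of w n] assms by simp
qed

text \<open>For \<open>j \<ge> 0\<close> this is \<open>euler_fun p / qpoch p p j\<close>, a multiple of the coefficient of \<open>w\<^sup>j\<close> in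
  \<open>1 / (w;p)\<^sub>\<infinity>\<close>. Writing it as a value of \<open>euler_fun\<close> extends it to negative indices, where it is
  zero automatically, and is the form in which it appears in the Bessel series.\<close>

definition reciprocal_seq :: "int \<Rightarrow> real" where
  "reciprocal_seq j = euler_fun (p powi (j + 1))"

lemma reciprocal_seq_rec: "(1 - p powi j) * reciprocal_seq j = reciprocal_seq (j - 1)"
proof -
  have "p * p powi j = p powi (j + 1)"
    using p_pos by (simp add: power_int_add)
  then show ?thesis
    using euler_fun_rec[of "p powi j"] by (simp only: reciprocal_seq_def diff_add_cancel)
qed

text \<open>The factor \<open>1 - w\<close> makes \<open>euler_fun\<close> vanish at \<open>w = 1\<close>, and the functional equation carries this
  zero to all \<open>p powi (- n)\<close>. This is what makes the \<open>q\<close>-Bessel function small at large lattice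
  points.\<close>

lemma reciprocal_seq_neg:
  assumes "j < 0"
  shows "reciprocal_seq j = 0"
proof -
  have "reciprocal_seq (- 1 - int n) = 0" for n
  proof (induction n)
    case 0
    show ?case
      using reciprocal_seq_rec[of 0] by simp
  next
    case (Suc n)
    then show ?case
      using reciprocal_seq_rec[of "- 1 - int n"] by (simp add: algebra_simps)
  qed
  from this[of "nat (- 1 - j)"] show ?thesis
    using assms by simp
qed

lemma euler_fun_bounded:
  assumes w: "0 \<le> w" "w \<le> 1"
  shows "norm (euler_fun w) \<le> (\<Sum>\<^sub>\<infinity>n. norm (euler_coeff n))"
proof -
  have "norm (euler_fun w) \<le> (\<Sum>\<^sub>\<infinity>n. norm (euler_coeff n * w ^ n))"
    unfolding euler_fun_def by (rule norm_infsum_bound[OF abs_summable_euler])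
  also have "\<dots> \<le> (\<Sum>\<^sub>\<infinity>n. norm (euler_coeff n))"
  proof (rule infsum_mono[OF abs_summable_euler])
    show "(\<lambda>n. norm (euler_coeff n)) summable_on UNIV"
      using abs_summable_euler[of 1] by simp
    show "norm (euler_coeff n * w ^ n) \<le> norm (euler_coeff n)" for n
      using w by (simp add: abs_mult mult_left_le power_le_one)
  qed
  finally show ?thesis .
qed

lemma reciprocal_seq_bounded: "norm (reciprocal_seq j) \<le> (\<Sum>\<^sub>\<infinity>n. norm (euler_coeff n))"
proof (cases "j < 0")
  case True
  then show ?thesis
    by (simp add: reciprocal_seq_neg infsum_nonneg)
next
  case False
  then show ?thesis
    unfolding reciprocal_seq_def
    using p_pos p_less_1 by (intro euler_fun_bounded) (simp_all add: power_int_le_one)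
qed

text \<open>The identity \<open>(w;p)\<^sub>\<infinity> * (1 / (w;p)\<^sub>\<infinity>) = 1\<close> for coefficients. Multiplying the \<open>N\<close>-th convolution by
  \<open>1 - p powi N = (1 - p\<^sup>i) + p\<^sup>i * (1 - p powi (N - i))\<close> and using both recurrences turns it into a
  telescoping sum, so it vanishes when \<open>p powi N \<noteq> 1\<close>.\<close>

lemma reciprocal_seq_inverse:
  "(\<Sum>\<^sub>\<infinity>i. euler_coeff i * reciprocal_seq (N - int i)) = (if N = 0 then euler_fun p else 0)"
proof -
  let ?t = "\<lambda>i. euler_coeff i * reciprocal_seq (N - int i)"
  let ?c = "\<lambda>i. p ^ i * euler_coeff i * reciprocal_seq (N - int i - 1)"
  have zero: "?t i = 0" if "i > nat N" for i
    using that by (simp add: reciprocal_seq_neg)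
  show ?thesis
  proof (cases "N = 0")
    case True
    have "(\<Sum>\<^sub>\<infinity>i. ?t i) = (\<Sum>\<^sub>\<infinity>i\<in>{0}. ?t i)"
      by (rule infsum_cong_neutral) (use zero True in auto)
    then show ?thesis
      by (simp add: True reciprocal_seq_def)
  next
    case False
    have finite_sum: "(\<Sum>\<^sub>\<infinity>i. ?t i) = (\<Sum>i\<le>nat N. ?t i)"
      by (subst infsum_finite[symmetric], simp, rule infsum_cong_neutral) (use zero in auto)
    have partial: "(1 - p powi N) * (\<Sum>i\<le>n. ?t i) = ?c n" for n
    proof (induction n)
      case 0
      then show ?case
        using reciprocal_seq_rec[of N] by simp
    next
      case (Suc n)
      have split: "1 - p powi N = (1 - p ^ Suc n) + p ^ Suc n * (1 - p powi (N - int (Suc n)))"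
        using p_pos by (simp add: algebra_simps power_int_diff flip: power_int_of_nat)
      have "(1 - p powi N) * ?t (Suc n) =
          (euler_coeff (Suc n) * (1 - p ^ Suc n)) * reciprocal_seq (N - int (Suc n)) +
          p ^ Suc n * euler_coeff (Suc n) *
          ((1 - p powi (N - int (Suc n))) * reciprocal_seq (N - int (Suc n)))"
        unfolding split by (simp only: algebra_simps)
      also have "\<dots> = - ?c n + ?c (Suc n)"
        unfolding euler_coeff_Suc reciprocal_seq_rec by (simp add: algebra_simps)
      finally show ?case
        using Suc.IH by (simp add: distrib_left)
    qed
    have "?c (nat N) = 0"
      by (simp add: reciprocal_seq_neg)
    with partial[of "nat N"] have "(1 - p powi N) * (\<Sum>i\<le>nat N. ?t i) = 0"
      by (rule trans)
    moreover have "p powi N \<noteq> 1"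
      using False powi_inject[OF p_pos p_less_1, of N 0] by simp
    ultimately show ?thesis
      using False by (simp add: finite_sum)
  qed
qed

section \<open>The Bessel series as a correlation\<close>

text \<open>Expanding \<open>euler_fun\<close> on either side produces the same double series with weight \<open>p\<^sup>n\<^sup>m\<close>. This is
  the symmetry \<open>(a;p)\<^sub>\<infinity> \<^sub>1\<phi>\<^sub>1(0;a;p,w) = (w;p)\<^sub>\<infinity> \<^sub>1\<phi>\<^sub>1(0;w;p,a)\<close>.\<close>

lemma euler_series_symmetric:
  "(\<Sum>\<^sub>\<infinity>n. euler_coeff n * w ^ n * euler_fun (a * p ^ n)) =
    (\<Sum>\<^sub>\<infinity>m. euler_coeff m * a ^ m * euler_fun (w * p ^ m))"
proof -
  let ?t = "\<lambda>n m. (euler_coeff n * w ^ n) * (euler_coeff m * a ^ m) * p ^ (n * m)"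
  have "(\<lambda>(n, m). (euler_coeff n * w ^ n) * (euler_coeff m * a ^ m)) abs_summable_on UNIV"
    using abs_summable_times[OF abs_summable_euler abs_summable_euler, of w a] by simp
  from abs_summable_mult_bounded[OF this, of "\<lambda>(n, m). p ^ (n * m)" 1]
  have t: "(\<lambda>(n, m). ?t n m) abs_summable_on UNIV"
    using p_pos p_less_1 by (simp add: case_prod_unfold power_le_one)
  have "(\<Sum>\<^sub>\<infinity>n. euler_coeff n * w ^ n * euler_fun (a * p ^ n)) = (\<Sum>\<^sub>\<infinity>n. \<Sum>\<^sub>\<infinity>m. ?t n m)"
    unfolding euler_fun_def infsum_cmult_right'[symmetric]
    by (simp add: power_mult_distrib power_mult mult_ac)
  also have "\<dots> = (\<Sum>\<^sub>\<infinity>m. \<Sum>\<^sub>\<infinity>n. ?t n m)"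
    by (rule infsum_swap_abs[OF t])
  also have "\<dots> = (\<Sum>\<^sub>\<infinity>m. euler_coeff m * a ^ m * euler_fun (w * p ^ m))"
    unfolding euler_fun_def infsum_cmult_right'[symmetric]
    by (simp add: power_mult_distrib power_mult[symmetric] mult_ac)
  finally show ?thesis .
qed

text \<open>Since \<open>euler_fun a = qpoch a p n * euler_fun (a * p\<^sup>n)\<close>, the denominators \<open>qpoch a p n\<close> are
  absorbed into \<open>euler_fun\<close>; then the symmetry exchanges the roles of the parameter \<open>a\<close> and the
  argument \<open>w\<close>. For \<open>w\<close> on the lattice the right-hand side is a correlation with \<open>reciprocal_seq\<close>.\<close>

lemma bessel_series_eq:
  assumes "0 < a" and "a < 1"
  shows "(\<Sum>n. euler_coeff n * w ^ n / qpoch a p n) =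
    (\<Sum>\<^sub>\<infinity>m. euler_coeff m * a ^ m * euler_fun (w * p ^ m)) / euler_fun a"
proof -
  have bound: "norm (euler_fun (a * p ^ n)) \<le> (\<Sum>\<^sub>\<infinity>n. norm (euler_coeff n))" for n
    using assms p_pos factor_pos[of a n] by (intro euler_fun_bounded) auto
  have "(\<lambda>n. euler_coeff n * w ^ n * euler_fun (a * p ^ n)) summable_on UNIV"
    by (rule abs_summable_summable[OF abs_summable_mult_bounded[OF abs_summable_euler bound]])
  from has_sum_imp_sums[OF has_sum_infsum[OF this]]
  have "(\<lambda>n. euler_coeff n * w ^ n * euler_fun (a * p ^ n) / euler_fun a) sums
      ((\<Sum>\<^sub>\<infinity>n. euler_coeff n * w ^ n * euler_fun (a * p ^ n)) / euler_fun a)"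
    by (rule sums_divide)
  moreover have "euler_fun (a * p ^ n) / euler_fun a = 1 / qpoch a p n" for n
  proof -
    have "euler_fun (a * p ^ n) \<noteq> 0"
      using euler_fun_shift[of a n] euler_fun_pos[OF assms] by force
    then show ?thesis
      unfolding euler_fun_shift[of a n] by simp
  qed
  then have "euler_coeff n * w ^ n * euler_fun (a * p ^ n) / euler_fun a =
      euler_coeff n * w ^ n / qpoch a p n" for n
    by (metis times_divide_eq_right mult.right_neutral)
  ultimately show ?thesis
    using euler_series_symmetric[of w a] by (simp add: sums_iff)
qed

lemma bessel_series_bounded:
  assumes "0 < a" and "a < 1"
  obtains B where "\<And>k. norm (\<Sum>n. euler_coeff n * (p powi k) ^ n / qpoch a p n) \<le> B"
proof
  fix k
  let ?S = "\<Sum>\<^sub>\<infinity>n. norm (euler_coeff n)"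
  let ?t = "\<lambda>m. euler_coeff m * a ^ m * euler_fun (p powi k * p ^ m)"
  have "p powi k * p ^ m = p powi (k + int m - 1 + 1)" for m
    using p_pos by (simp add: power_int_add)
  then have le: "norm (euler_fun (p powi k * p ^ m)) \<le> ?S" for m
    using reciprocal_seq_bounded[of "k + int m - 1"] by (simp only: reciprocal_seq_def)
  have "norm (\<Sum>\<^sub>\<infinity>m. ?t m) \<le> (\<Sum>\<^sub>\<infinity>m. norm (?t m))"
    by (rule norm_infsum_bound[OF abs_summable_mult_bounded[OF abs_summable_euler le]])
  also have "\<dots> \<le> (\<Sum>\<^sub>\<infinity>m. norm (euler_coeff m * a ^ m) * ?S)"
  proof (rule infsum_mono)
    show "(\<lambda>m. norm (?t m)) summable_on UNIV"
      by (rule abs_summable_mult_bounded[OF abs_summable_euler le])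
    show "(\<lambda>m. norm (euler_coeff m * a ^ m) * ?S) summable_on UNIV"
      by (rule summable_on_cmult_left[OF abs_summable_euler])
    show "norm (?t m) \<le> norm (euler_coeff m * a ^ m) * ?S" for m
      unfolding norm_mult[of "euler_coeff m * a ^ m"] using le by (rule mult_left_mono) simp
  qed
  finally have "norm (\<Sum>\<^sub>\<infinity>m. ?t m) / euler_fun a \<le>
      (\<Sum>\<^sub>\<infinity>m. norm (euler_coeff m * a ^ m) * ?S) / euler_fun a"
    using euler_fun_pos[OF assms] by (intro divide_right_mono) simp_all
  then show "norm (\<Sum>n. euler_coeff n * (p powi k) ^ n / qpoch a p n) \<le>
      (\<Sum>\<^sub>\<infinity>m. norm (euler_coeff m * a ^ m) * ?S) / euler_fun a"
    unfolding bessel_series_eq[OF assms] using euler_fun_pos[OF assms] by simp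
qed

text \<open>The factor \<open>r powi j\<close> makes the bounded sequence \<open>reciprocal_seq\<close>, which lives on \<open>j \<ge> 0\<close>, absolutely
  summable. Rescaling the other sequence by \<open>r\<^sup>i\<close> compensates for it, because a common geometric
  factor passes through a convolution.\<close>

lemma inverse_sequences_euler:
  assumes r: "0 < r" "r < 1"
  shows "inverse_sequences (\<lambda>i. euler_coeff i * r ^ i)
    (\<lambda>j. r powi j * reciprocal_seq j / euler_fun p)"
proof
  let ?S = "\<Sum>\<^sub>\<infinity>n. norm (euler_coeff n)"
  show "(\<lambda>i. euler_coeff i * r ^ i) abs_summable_on UNIV"
    by (rule abs_summable_euler)
  have "(\<lambda>n. r ^ n) abs_summable_on (UNIV :: nat set)"
    using r by (intro norm_summable_imp_summable_on) (simp_all add: summable_geometric)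
  from abs_summable_mult_bounded[OF this, of "\<lambda>n. reciprocal_seq (int n)" ?S]
  have "(\<lambda>n. r ^ n * reciprocal_seq (int n)) abs_summable_on (UNIV :: nat set)"
    using reciprocal_seq_bounded by blast
  then have "(\<lambda>j. norm (r powi j * reciprocal_seq j)) summable_on range int"
    by (subst summable_on_reindex) (simp_all add: o_def)
  then have "(\<lambda>j. r powi j * reciprocal_seq j) abs_summable_on UNIV"
  proof (rule summable_on_cong_neutral[THEN iffD1, rotated -1])
    fix j :: int assume "j \<in> UNIV - range int"
    then have "j < 0"
      by (metis DiffD2 int_nat_eq linorder_not_le rangeI)
    then show "norm (r powi j * reciprocal_seq j) = 0"
      by (simp add: reciprocal_seq_neg)
  qed auto
  then show "(\<lambda>j. r powi j * reciprocal_seq j / euler_fun p) abs_summable_on UNIV"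
    unfolding divide_inverse
    by (rule abs_summable_mult_bounded[where B = "norm (inverse (euler_fun p))"]) simp
  have E: "euler_fun p \<noteq> 0"
    using euler_fun_pos[of p] p_pos p_less_1 by simp
  show "(\<Sum>\<^sub>\<infinity>i. euler_coeff i * r ^ i * (r powi (N - int i) * reciprocal_seq (N - int i) / euler_fun p)) =
      (if N = 0 then 1 else 0)" for N
  proof -
    have "euler_coeff i * r ^ i * (r powi (N - int i) * reciprocal_seq (N - int i) / euler_fun p) =
        r powi N / euler_fun p * (euler_coeff i * reciprocal_seq (N - int i))" for i
      using r by (simp add: power_int_diff)
    then show ?thesis
      using E by (simp only: infsum_cmult_right' reciprocal_seq_inverse) simp
  qed
qed

lemma correlation_euler:
  assumes r: "0 < r" "r < 1"
  shows "inverse_sequences.correlation (\<lambda>i. euler_coeff i * r ^ i)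
      (\<lambda>j. r powi j * reciprocal_seq j / euler_fun p) k =
    r powi k * euler_fun (r\<^sup>2) / euler_fun p * (\<Sum>n. euler_coeff n * (p powi (k + 1)) ^ n / qpoch (r\<^sup>2) p n)"
proof -
  have a: "0 < r\<^sup>2" "r\<^sup>2 < 1"
    using r by (simp_all add: power_less_one_iff)
  have "euler_coeff i * r ^ i * (r powi (k + int i) * reciprocal_seq (k + int i) / euler_fun p) =
      r powi k / euler_fun p * (euler_coeff i * (r\<^sup>2) ^ i * euler_fun (p powi (k + 1) * p ^ i))" for i
    using r p_pos
    by (simp add: reciprocal_seq_def power_int_add power2_eq_square power_mult_distrib mult_ac)
  then show ?thesis
    unfolding inverse_sequences.correlation_def[OF inverse_sequences_euler[OF r]] bessel_series_eq[OF a]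
    using euler_fun_pos[OF a] by (simp only: infsum_cmult_right') simp
qed

end

text \<open>The base is \<open>p = q\<^sup>2\<close> and the parameter is \<open>a = r\<^sup>2\<close>. The factor \<open>(1 - q) ^ (2 * n)\<close> in the Bessel
  series is \<open>p powi (M * n)\<close> and the index of \<open>reciprocal_seq\<close> is off by one from the exponent of \<open>p\<close>,
  which together shift the correlation by \<open>M - 1\<close>. The bound \<open>B\<close> is recorded separately since it
  is not a consequence of the summability of \<open>v\<close>: the factor \<open>r powi (- k)\<close> grows.\<close>

lemma qBessel_unitary:
  fixes q \<alpha> :: real
  assumes q: "0 < q" "q < 1" and \<alpha>: "\<alpha> > - 1" and M: "1 - q = q powi M"
  obtains v D B where "unitary_hankel v" and "D \<noteq> 0"
    and "\<And>k. \<bar>qBessel q \<alpha> (q powi k)\<bar> \<le> B"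
    and "\<And>k. qBessel q \<alpha> (q powi k) = D * (q powr (\<alpha> + 1)) powi (- k) * v k"
proof -
  define r where "r = q powr (\<alpha> + 1)"
  have r: "0 < r" "r < 1"
    using q \<alpha> by (simp_all add: r_def powr01_less_one)
  have a: "0 < r\<^sup>2" "r\<^sup>2 < 1"
    using r by (simp_all add: power_less_one_iff)
  have r2: "q powr (2 * \<alpha> + 2) = r\<^sup>2"
    using q by (simp add: r_def powr_power algebra_simps)
  interpret q_series "q\<^sup>2"
    by unfold_locales (use q in \<open>simp_all add: power_less_one_iff\<close>)
  interpret inverse_sequences "\<lambda>i. euler_coeff i * r ^ i"
    "\<lambda>j. r powi j * reciprocal_seq j / euler_fun (q\<^sup>2)"
    by (rule inverse_sequences_euler[OF r])
  have E: "euler_fun (q\<^sup>2) \<noteq> 0" "euler_fun (r\<^sup>2) \<noteq> 0"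
    using euler_fun_pos[OF p_pos p_less_1] euler_fun_pos[OF a] by simp_all
  have unitary: "unitary_hankel (\<lambda>k. correlation (k + (M - 1)))"
  proof
    show "(\<lambda>k. correlation (k + (M - 1))) abs_summable_on UNIV"
      using abs_summable_correlation summable_shift_int[of "\<lambda>k. norm (correlation k)" "M - 1"] by simp
    show "(\<Sum>\<^sub>\<infinity>k. correlation (k + n + (M - 1)) * correlation (k + m + (M - 1))) =
        (if n = m then 1 else 0)" for n m
      using correlation_orthogonal[of "n + (M - 1)" "m + (M - 1)"] by (simp add: add.assoc)
  qed
  have D_nonzero: "euler_fun (q\<^sup>2) / euler_fun (r\<^sup>2) * r powi (1 - M) \<noteq> 0"
    using E r by simp
  have series: "qBessel q \<alpha> (q powi k) =
      (\<Sum>n. euler_coeff n * ((q\<^sup>2) powi (k + M)) ^ n / qpoch (r\<^sup>2) (q\<^sup>2) n)" for k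
  proof -
    have "(- 1) ^ n * q ^ (n * (n - 1)) * (1 - q) ^ (2 * n) * (q powi k) ^ (2 * n) /
        (qpoch (q\<^sup>2) (q\<^sup>2) n * qpoch (q powr (2 * \<alpha> + 2)) (q\<^sup>2) n) =
        euler_coeff n * ((q\<^sup>2) powi (k + M)) ^ n / qpoch (r\<^sup>2) (q\<^sup>2) n" for n
    proof -
      have "n * (n - 1) = 2 * (n choose 2)"
        by (cases n) (simp_all add: choose_two)
      then have "q ^ (n * (n - 1)) = (q\<^sup>2) ^ (n choose 2)"
        by (simp only: power_mult)
      moreover have "(q\<^sup>2) powi (k + M) = ((1 - q) * q powi k)\<^sup>2"
        using q by (simp add: M power2_eq_square power_int_mult_distrib power_int_add mult_ac)
      then have "(1 - q) ^ (2 * n) * (q powi k) ^ (2 * n) = ((q\<^sup>2) powi (k + M)) ^ n"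
        by (simp only: power_mult power_mult_distrib)
      ultimately show ?thesis
        by (simp add: euler_coeff_def r2 mult.assoc)
    qed
    then show ?thesis
      by (simp add: qBessel_def)
  qed
  obtain B where "\<And>k. norm (\<Sum>n. euler_coeff n * ((q\<^sup>2) powi k) ^ n / qpoch (r\<^sup>2) (q\<^sup>2) n) \<le> B"
    using bessel_series_bounded[OF a] by blast
  then have bounded: "\<bar>qBessel q \<alpha> (q powi k)\<bar> \<le> B" for k
    by (simp only: series real_norm_def)
  have "qBessel q \<alpha> (q powi k) =
      euler_fun (q\<^sup>2) / euler_fun (r\<^sup>2) * r powi (1 - M) * (q powr (\<alpha> + 1)) powi (- k) *
      correlation (k + (M - 1))" for k
  proof -
    have "qBessel q \<alpha> (q powi k) =
        (\<Sum>n. euler_coeff n * ((q\<^sup>2) powi (k + (M - 1) + 1)) ^ n / qpoch (r\<^sup>2) (q\<^sup>2) n)"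
      unfolding series by simp
    also have "\<dots> = euler_fun (q\<^sup>2) / euler_fun (r\<^sup>2) * r powi (- (k + (M - 1))) * correlation (k + (M - 1))"
    proof -
      have "r powi (- (k + (M - 1))) * r powi (k + (M - 1)) = 1"
        using r by (subst power_int_add[symmetric]) simp_all
      moreover have "S = e / e' * s * (t * e' / e * S)" if "s * t = 1" "e \<noteq> 0" "e' \<noteq> 0"
        for e e' s t S :: real
      proof -
        have "e / e' * s * (t * e' / e * S) = (s * t) * S"
          using that(2,3) by simp
        then show ?thesis
          using that(1) by simp
      qed
      ultimately show ?thesis
        unfolding correlation_euler[OF r] using E by blast
    qed
    also have "r powi (- (k + (M - 1))) = r powi (1 - M) * r powi (- k)"
      using r by (simp flip: power_int_add)
    finally show ?thesis
      by (simp add: r_def mult.assoc)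
  qed
  then show thesis
    by (rule that[OF unitary D_nonzero bounded])
qed

section \<open>The transform on the lattice\<close>

lemma qpoch_inf_nonzero:
  assumes p: "0 < p" "p < 1" and a: "0 < a" "a < 1"
  shows "qpoch_inf a p \<noteq> 0"
proof -
  have factor: "a * p ^ k < 1" for k
    using q_series.factor_pos[of p a k] assms by (simp add: q_series_def)
  have "summable (\<lambda>k. \<bar>- (a * p ^ k)\<bar>)"
    using p a by (simp add: abs_mult summable_geometric)
  then have "convergent_prod (\<lambda>k. 1 + - (a * p ^ k))"
    by (rule summable_imp_convergent_prod_real) (use factor in \<open>auto simp: less_le\<close>)
  then show ?thesis
    unfolding qpoch_inf_def by (intro prodinf_nonzero) (use factor in \<open>auto simp: less_le\<close>)
qed

lemma qc_nonzero:
  assumes q: "0 < q" "q < 1" and "\<alpha> > - 1"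
  shows "qc q \<alpha> \<noteq> 0"
proof -
  have p: "0 < q\<^sup>2" "q\<^sup>2 < 1"
    using q by (simp_all add: power_less_one_iff)
  have a: "0 < q\<^sup>2 powr (\<alpha> + 1)" "q\<^sup>2 powr (\<alpha> + 1) < 1"
    using p assms by (simp_all add: powr01_less_one)
  have "0 < 1 + 1 / q"
    using q by (simp add: add_pos_pos)
  then show ?thesis
    using qpoch_inf_nonzero[OF p p] qpoch_inf_nonzero[OF p a] p by (simp add: qc_def qGamma_def)
qed

text \<open>The interface to the Bessel function: its values on the lattice are the entries of a unitary Hankel
  matrix, up to the constant \<open>D\<close> and the weight.\<close>

locale q_bessel_transform = unitary_hankel v for v :: "int \<Rightarrow> real" +
  fixes q \<alpha> D B :: real
  assumes q_pos: "0 < q" and q_less_1: "q < 1"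
    and qc_nonzero: "qc q \<alpha> \<noteq> 0"
    and D_nonzero: "D \<noteq> 0"
    and qBessel_bounded: "\<bar>qBessel q \<alpha> (q powi k)\<bar> \<le> B"
    and qBessel_lattice: "qBessel q \<alpha> (q powi k) = D * (q powr (\<alpha> + 1)) powi (- k) * v k"
begin

text \<open>The square root of the weight: \<open>(\<omega> n)\<^sup>2\<close> is the mass \<open>q powi n * (q powi n) powr (2 * \<alpha> + 1)\<close> of the
  lattice point, see \<open>weight_lattice\<close>.\<close>

definition \<omega> :: "int \<Rightarrow> real" where
  "\<omega> n = (q powr (\<alpha> + 1)) powi n"

definition coeffs :: "(real \<Rightarrow> complex) \<Rightarrow> int \<Rightarrow> complex" where
  "coeffs h n = of_real (\<omega> n) * h (q powi n)"

text \<open>The factor by which the Fourier transform differs from a unitary operator.\<close>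

definition \<kappa> :: real where
  "\<kappa> = (1 - q) * qc q \<alpha> * D"

lemma \<kappa>_nonzero: "\<kappa> \<noteq> 0"
  using q_less_1 qc_nonzero D_nonzero by (simp add: \<kappa>_def)

lemma powi_pos: "0 < q powi n" "0 < \<omega> n"
  using q_pos by (simp_all add: \<omega>_def)

lemma \<omega>_nonzero [simp]: "\<omega> n \<noteq> 0"
  using powi_pos(2)[of n] by simp

lemma \<omega>_add: "\<omega> (m + n) = \<omega> m * \<omega> n"
  using q_pos by (simp add: \<omega>_def power_int_add)

lemma \<omega>_minus: "\<omega> (- n) = inverse (\<omega> n)"
  by (simp add: \<omega>_def power_int_minus)

lemma \<omega>_diff: "\<omega> (m - n) = \<omega> m / \<omega> n"
  using q_pos by (simp add: \<omega>_def power_int_diff)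

lemma powi_powr: "(q powi n) powr s = q powr (s * of_int n)"
  using q_pos by (simp add: powr_real_of_int'[symmetric] powr_powr mult.commute)

lemma \<omega>_powr: "\<omega> n = q powr ((\<alpha> + 1) * of_int n)"
  using q_pos by (simp add: \<omega>_def powr_real_of_int'[symmetric] powr_powr)

lemma weight_lattice: "q powi n * (q powi n) powr (2 * \<alpha> + 1) = (\<omega> n)\<^sup>2"
  using q_pos unfolding powi_powr \<omega>_powr
  by (simp add: powr_real_of_int'[symmetric] powr_power powr_add[symmetric] algebra_simps)

lemma dilation_weight: "(q powi m) powr (- 2 * \<alpha> - 2) = \<omega> (- m) * \<omega> (- m)"
proof -
  have "(- 2 * \<alpha> - 2) * of_int m = (\<alpha> + 1) * of_int (- m) + (\<alpha> + 1) * of_int (- m)"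
    by (simp add: algebra_simps)
  then show ?thesis
    by (simp only: powi_powr \<omega>_powr powr_add)
qed

lemma sum_weight:
  "(q powi n) *\<^sub>R (z * complex_of_real ((q powi n) powr (2 * \<alpha> + 1))) = of_real ((\<omega> n)\<^sup>2) * z"
  unfolding weight_lattice[symmetric] by (simp add: scaleR_conv_of_real mult_ac)

lemma Lq2_iff: "h \<in> Lq2 q \<alpha> \<longleftrightarrow> square_summable (coeffs h)"
proof -
  have "norm ((q powi n) *\<^sub>R ((cmod (h (q powi n)))\<^sup>2 * (q powi n) powr (2 * \<alpha> + 1))) =
      (cmod (coeffs h n))\<^sup>2" for n
  proof -
    have "norm ((q powi n) *\<^sub>R ((cmod (h (q powi n)))\<^sup>2 * (q powi n) powr (2 * \<alpha> + 1))) =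
        (q powi n * (q powi n) powr (2 * \<alpha> + 1)) * (cmod (h (q powi n)))\<^sup>2"
      using powi_pos[of n] by (simp add: abs_mult)
    then show ?thesis
      unfolding weight_lattice using powi_pos[of n]
      by (simp add: coeffs_def norm_mult power_mult_distrib)
  qed
  then show ?thesis
    by (simp add: Lq2_def jackson_integrable_def square_summable_def)
qed

lemma qFourier_lattice:
  "qFourier q \<alpha> h (q powi l) = of_real (\<kappa> * \<omega> (- l)) * hankel (coeffs h) l"
proof -
  have summand: "(q powi n) *\<^sub>R (h (q powi n) * of_real (qBessel q \<alpha> (q powi l * q powi n)) *
        of_real ((q powi n) powr (2 * \<alpha> + 1))) =
      of_real (D * \<omega> (- l)) * (of_real (v (l + n)) * coeffs h n)" for n
  proof -
    have "q powi l * q powi n = q powi (l + n)"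
      using q_pos by (simp add: power_int_add)
    moreover have "\<omega> (- (l + n)) * (\<omega> n)\<^sup>2 = \<omega> (- l) * \<omega> n"
      by (simp add: \<omega>_diff \<omega>_minus power2_eq_square field_simps)
    then have "of_real (\<omega> (- (l + n))) * of_real ((\<omega> n)\<^sup>2) =
        complex_of_real (\<omega> (- l)) * of_real (\<omega> n)"
      by (simp only: of_real_mult[symmetric])
    ultimately show ?thesis
      unfolding sum_weight by (simp add: qBessel_lattice[folded \<omega>_def] coeffs_def mult_ac)
  qed
  show ?thesis
    unfolding qFourier_def jackson_integral_def summand infsum_cmult_right' hankel_def[symmetric]
    by (simp add: \<kappa>_def scaleR_conv_of_real mult_ac)
qed

lemma hankel_coeffs:
  "hankel (coeffs h) l = of_real (\<omega> l / \<kappa>) * qFourier q \<alpha> h (q powi l)"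
proof -
  have "\<omega> l / \<kappa> * (\<kappa> * \<omega> (- l)) = 1"
    using \<kappa>_nonzero by (simp add: \<omega>_minus)
  then show ?thesis
    unfolding qFourier_lattice mult.assoc[symmetric] of_real_mult[symmetric] by simp
qed

text \<open>Needed to exhibit the function that the choice operator in \<open>qtranslation\<close> selects.\<close>

lemma coeffs_surj:
  obtains h where "coeffs h = y"
proof
  have "inv (\<lambda>n::int. q powi n) (q powi n) = n" for n
    by (rule inv_f_f) (simp add: inj_def powi_inject[OF q_pos q_less_1])
  then show "coeffs (\<lambda>x. let n = inv (\<lambda>n::int. q powi n) x in y n / of_real (\<omega> n)) = y"
    using powi_pos(2) by (auto simp: coeffs_def Let_def fun_eq_iff less_le)
qed

lemma hankel_hankel: "square_summable x \<Longrightarrow> hankel (hankel x) = x"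
  using square_summable_bounded[of x] hankel_involution[of x] by (metis ext)

text \<open>The function required by the definition exists because \<open>hankel\<close> is an involution on the square
  summable sequences and multiplication by the bounded Bessel values preserves them.\<close>

lemma qtranslation_lattice:
  assumes "h \<in> Lq2 q \<alpha>"
  shows "qtranslation q \<alpha> (q powi k) h \<in> Lq2 q \<alpha>"
    and "hankel (coeffs (qtranslation q \<alpha> (q powi k) h)) l =
      of_real (qBessel q \<alpha> (q powi (l + k))) * hankel (coeffs h) l"
proof -
  let ?P = "\<lambda>t. t \<in> Lq2 q \<alpha> \<and> (\<forall>x \<in> Rq_pos q.
      qFourier q \<alpha> t x = of_real (qBessel q \<alpha> (x * q powi k)) * qFourier q \<alpha> h x)"
  have P_iff: "?P t \<longleftrightarrow> t \<in> Lq2 q \<alpha> \<and>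
      (\<forall>l. hankel (coeffs t) l = of_real (qBessel q \<alpha> (q powi (l + k))) * hankel (coeffs h) l)" for t
  proof -
    have "qFourier q \<alpha> t (q powi l) = of_real (qBessel q \<alpha> (q powi l * q powi k)) * qFourier q \<alpha> h (q powi l) \<longleftrightarrow>
        hankel (coeffs t) l = of_real (qBessel q \<alpha> (q powi (l + k))) * hankel (coeffs h) l" for l
    proof -
      have "q powi l * q powi k = q powi (l + k)"
        using q_pos by (simp add: power_int_add)
      moreover have "of_real (\<kappa> * \<omega> (- l)) \<noteq> (0 :: complex)"
        using \<kappa>_nonzero by simp
      ultimately show ?thesis
        unfolding qFourier_lattice by (metis mult.left_commute mult_cancel_left)
    qed
    then show ?thesis
      by (simp add: Rq_pos_def)
  qed
  let ?y = "\<lambda>l. of_real (qBessel q \<alpha> (q powi (l + k))) * hankel (coeffs h) l"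
  have y: "square_summable ?y"
    using assms qBessel_bounded
    by (intro square_summable_mult_bounded[where B = B] square_summable_hankel) (simp_all add: Lq2_iff)
  obtain t where "coeffs t = hankel ?y"
    by (rule coeffs_surj)
  then have "?P t"
    unfolding P_iff using square_summable_hankel[OF y] hankel_hankel[OF y] by (simp add: Lq2_iff)
  then have "?P (qtranslation q \<alpha> (q powi k) h)"
    unfolding qtranslation_def by (rule someI[where P = ?P])
  then show "qtranslation q \<alpha> (q powi k) h \<in> Lq2 q \<alpha>"
    and "hankel (coeffs (qtranslation q \<alpha> (q powi k) h)) l = ?y l"
    unfolding P_iff by simp_all
qed

lemma coeffs_qdilation:
  "coeffs (qdilation \<alpha> g (q powi m)) n = of_real (\<omega> (- m)) * coeffs g (- m + n)"
proof -
  have "q powi n / q powi m = q powi (- m + n)" "\<omega> n * \<omega> (- m) = \<omega> (- m + n)"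
    using q_pos by (simp_all add: power_int_diff \<omega>_diff \<omega>_minus field_simps)
  then show ?thesis
    unfolding coeffs_def qdilation_def dilation_weight
    by (simp only: of_real_mult mult_ac) (simp flip: of_real_mult add: mult_ac)
qed

text \<open>A dilation by a lattice point shifts the sequence of \<open>g\<close>, and because the kernel depends on the
  sum of its indices this becomes the opposite shift of the transform. This is the rule \<open>g\<^sub>a \<mapsto> (\<lambda> \<mapsto> F g (a * \<lambda>))\<close>.\<close>

lemma hankel_qdilation:
  "hankel (coeffs (qdilation \<alpha> g (q powi m))) l = of_real (\<omega> (- m)) * hankel (coeffs g) (m + l)"
proof -
  have "hankel (coeffs (qdilation \<alpha> g (q powi m))) l =
      of_real (\<omega> (- m)) * (\<Sum>\<^sub>\<infinity>n. of_real (v (l + n)) * coeffs g (n + - m))"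
    unfolding hankel_def coeffs_qdilation
    by (subst infsum_cmult_right'[symmetric]) (simp add: mult_ac add.commute)
  also have "(\<Sum>\<^sub>\<infinity>n. of_real (v (l + n)) * coeffs g (n + - m)) =
      (\<Sum>\<^sub>\<infinity>n. of_real (v (m + l + n)) * coeffs g n)"
    using infsum_shift_int[of "\<lambda>n. of_real (v (m + l + n)) * coeffs g n" "- m"]
    by (simp add: algebra_simps)
  finally show ?thesis
    by (simp add: hankel_def)
qed

lemma hankel_wavelet_atom:
  assumes "g \<in> Lq2 q \<alpha>"
  shows "wavelet_atom q \<alpha> g (q powi m) (q powi k) \<in> Lq2 q \<alpha>"
    and "hankel (coeffs (wavelet_atom q \<alpha> g (q powi m) (q powi k))) l =
      of_real (sqrt (q powi m) * D / \<kappa> * \<omega> (- k)) *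
      (of_real (v (k + l)) * qFourier q \<alpha> g (q powi (m + l)))"
proof -
  let ?W = "wavelet_atom q \<alpha> g (q powi m) (q powi k)"
  let ?T = "qtranslation q \<alpha> (q powi k) (qdilation \<alpha> g (q powi m))"
  have dil: "qdilation \<alpha> g (q powi m) \<in> Lq2 q \<alpha>"
    using assms unfolding Lq2_iff coeffs_qdilation[abs_def]
    by (intro square_summable_cmult square_summable_shift)
  have W: "coeffs ?W = (\<lambda>n. of_real (sqrt (q powi m)) * coeffs ?T n)"
    by (simp add: fun_eq_iff coeffs_def wavelet_atom_def mult_ac)
  show "?W \<in> Lq2 q \<alpha>"
    using qtranslation_lattice(1)[OF dil] unfolding Lq2_iff W by (rule square_summable_cmult)
  have "\<omega> (- (l + k)) * \<omega> (- m) * \<omega> (m + l) = \<omega> (- k)"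
    by (simp add: \<omega>_diff \<omega>_add \<omega>_minus field_simps)
  then have *: "of_real (\<omega> (- (l + k))) * of_real (\<omega> (- m)) * complex_of_real (\<omega> (m + l)) =
      of_real (\<omega> (- k))"
    by (simp only: of_real_mult[symmetric])
  have "hankel (coeffs ?W) l = of_real (sqrt (q powi m) * D / \<kappa> * v (l + k)) *
      (of_real (\<omega> (- (l + k))) * of_real (\<omega> (- m)) * of_real (\<omega> (m + l))) *
      qFourier q \<alpha> g (q powi (m + l))"
    unfolding W hankel_cmult qtranslation_lattice(2)[OF dil] hankel_qdilation hankel_coeffs[of g] qBessel_lattice[folded \<omega>_def]
    by (simp add: mult_ac)
  then show "hankel (coeffs ?W) l = of_real (sqrt (q powi m) * D / \<kappa> * \<omega> (- k)) *
      (of_real (v (k + l)) * qFourier q \<alpha> g (q powi (m + l)))"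
    unfolding * by (simp add: mult_ac add.commute)
qed

text \<open>The transform of the atom at \<open>l\<close> contains the kernel value \<open>v (k + l)\<close>. Inverting the transform at
  \<open>n\<close> gives a sum over \<open>l\<close> with \<open>v (n + l) * v (k + l)\<close>; reading the second factor as the matrix
  entry, it is a Hankel transform evaluated at the translation index \<open>k\<close> instead of \<open>n\<close>.\<close>

lemma coeffs_wavelet_atom:
  assumes "g \<in> Lq2 q \<alpha>"
  shows "coeffs (wavelet_atom q \<alpha> g (q powi m) (q powi k)) n =
    of_real (sqrt (q powi m) * D / \<kappa> * \<omega> (- k)) *
    hankel (\<lambda>l. of_real (v (n + l)) * qFourier q \<alpha> g (q powi (m + l))) k"
proof -
  let ?x = "coeffs (wavelet_atom q \<alpha> g (q powi m) (q powi k))"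
  have "?x n = hankel (hankel ?x) n"
    using hankel_wavelet_atom(1)[OF assms] by (simp add: Lq2_iff hankel_hankel)
  then show ?thesis
    unfolding hankel_wavelet_atom(2)[OF assms, abs_def] hankel_cmult
    by (simp add: hankel_def mult_ac)
qed

text \<open>By Parseval the pairing of \<open>f\<close> with the atom moves to the transform side, where the kernel value
  \<open>v (k + l)\<close> again makes it a Hankel transform at \<open>k\<close>.\<close>

lemma wavelet_transform_lattice:
  assumes g: "g \<in> Lq2 q \<alpha>" and f: "f \<in> Lq2 q \<alpha>"
  shows "wavelet_transform q \<alpha> g f (q powi m) (q powi k) =
    of_real (sqrt (q powi m) * \<omega> (- k)) *
    hankel (\<lambda>l. hankel (coeffs f) l * cnj (qFourier q \<alpha> g (q powi (m + l)))) k"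
proof -
  let ?W = "wavelet_atom q \<alpha> g (q powi m) (q powi k)"
  have W: "square_summable (\<lambda>n. cnj (coeffs ?W n))"
    using hankel_wavelet_atom(1)[OF g] by (simp add: Lq2_iff square_summable_cnj)
  have summand: "(q powi n) *\<^sub>R (f (q powi n) * cnj (?W (q powi n)) * of_real ((q powi n) powr (2 * \<alpha> + 1))) =
      coeffs f n * cnj (coeffs ?W n)" for n
    unfolding sum_weight by (simp add: coeffs_def power2_eq_square mult_ac)
  have "(\<Sum>\<^sub>\<infinity>n. coeffs f n * cnj (coeffs ?W n)) =
      (\<Sum>\<^sub>\<infinity>l. hankel (coeffs f) l * cnj (hankel (coeffs ?W) l))"
    using hankel_parseval[OF _ W, of "coeffs f"] f by (simp add: Lq2_iff hankel_cnj)
  also have "\<dots> = of_real (sqrt (q powi m) * D / \<kappa> * \<omega> (- k)) *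
      hankel (\<lambda>l. hankel (coeffs f) l * cnj (qFourier q \<alpha> g (q powi (m + l)))) k"
    unfolding hankel_wavelet_atom(2)[OF g] hankel_def[of "\<lambda>l. hankel (coeffs f) l * _ l"]
    by (subst infsum_cmult_right'[symmetric]) (simp add: mult_ac)
  finally have "wavelet_transform q \<alpha> g f (q powi m) (q powi k) =
      of_real (qc q \<alpha> * (1 - q)) * (of_real (sqrt (q powi m) * D / \<kappa> * \<omega> (- k)) *
      hankel (\<lambda>l. hankel (coeffs f) l * cnj (qFourier q \<alpha> g (q powi (m + l)))) k)"
    unfolding wavelet_transform_def jackson_integral_def summand by (simp add: scaleR_conv_of_real)
  also have "\<dots> = of_real (qc q \<alpha> * (1 - q) * (sqrt (q powi m) * D / \<kappa> * \<omega> (- k))) *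
      hankel (\<lambda>l. hankel (coeffs f) l * cnj (qFourier q \<alpha> g (q powi (m + l)))) k"
    by simp
  also have "qc q \<alpha> * (1 - q) * (sqrt (q powi m) * D / \<kappa> * \<omega> (- k)) = sqrt (q powi m) * \<omega> (- k)"
    using \<kappa>_nonzero by (simp add: \<kappa>_def)
  finally show ?thesis .
qed

section \<open>The reconstruction formula\<close>

lemma reconstruction:
  assumes g: "q_wavelet q \<alpha> g" and f: "f \<in> Lq2 q \<alpha>" and x: "x \<in> Rq_pos q"
  defines "H \<equiv> \<lambda>a b. wavelet_transform q \<alpha> g f a b * wavelet_atom q \<alpha> g a b x *
                     of_real (b powr (2 * \<alpha> + 1) / a\<^sup>2)"
  shows "jackson_integrable2 q H"
    and "f x = of_real (qc q \<alpha> / wavelet_const q \<alpha> g) * jackson_integral2 q H"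
proof -
  from x obtain n where n: "x = q powi n"
    by (auto simp: Rq_pos_def)
  define \<gamma> where "\<gamma> l = qFourier q \<alpha> g (q powi l)" for l
  have g2: "g \<in> Lq2 q \<alpha>"
    using g by (simp add: q_wavelet_def)
  have f2: "square_summable (coeffs f)"
    using f by (simp add: Lq2_iff)
  have haar: "(q powi l) *\<^sub>R ((cmod (qFourier q \<alpha> g (q powi l)))\<^sup>2 / q powi l) = (cmod (\<gamma> l))\<^sup>2" for l
    using q_pos by (simp add: \<gamma>_def)
  have \<gamma>: "square_summable \<gamma>"
    using g unfolding q_wavelet_def jackson_integrable_def haar by (simp add: square_summable_def)
  have const: "wavelet_const q \<alpha> g = (1 - q) * (\<Sum>\<^sub>\<infinity>l. (cmod (\<gamma> l))\<^sup>2)"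
    unfolding wavelet_const_def jackson_integral_def haar by simp
  have const_pos: "0 < wavelet_const q \<alpha> g"
    using g by (simp add: q_wavelet_def)
  define T where "T m k = hankel (\<lambda>l. hankel (coeffs f) l * cnj (\<gamma> (m + l))) k *
      hankel (\<lambda>l. of_real (v (n + l)) * \<gamma> (m + l)) k" for m k
  define c where "c = complex_of_real (D / \<kappa> * \<omega> (- n))"
  have summand: "(q powi m * q powi k) *\<^sub>R H (q powi m) (q powi k) = c * T m k" for m k
  proof -
    let ?P = "hankel (\<lambda>l. hankel (coeffs f) l * cnj (\<gamma> (m + l))) k"
    let ?Q = "hankel (\<lambda>l. of_real (v (n + l)) * \<gamma> (m + l)) k"
    have "wavelet_atom q \<alpha> g (q powi m) (q powi k) x =
        of_real (\<omega> (- n)) * coeffs (wavelet_atom q \<alpha> g (q powi m) (q powi k)) n"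
      by (simp add: coeffs_def n \<omega>_minus)
    then have atom: "wavelet_atom q \<alpha> g (q powi m) (q powi k) x =
        of_real (\<omega> (- n) * (sqrt (q powi m) * D / \<kappa> * \<omega> (- k))) * ?Q"
      unfolding coeffs_wavelet_atom[OF g2] \<gamma>_def by (simp only: of_real_mult mult.assoc)
    have transform: "wavelet_transform q \<alpha> g f (q powi m) (q powi k) =
        of_real (sqrt (q powi m) * \<omega> (- k)) * ?P"
      using wavelet_transform_lattice[OF g2 f] by (simp only: \<gamma>_def)
    \<comment> \<open>All powers of \<open>q powi m\<close> and \<open>q powi k\<close> cancel: the measure, the weight and the normalisation match.\<close>
    have scalar: "q powi m * q powi k * (sqrt (q powi m) * \<omega> (- k)) *
        (\<omega> (- n) * (sqrt (q powi m) * D / \<kappa> * \<omega> (- k))) *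
        ((q powi k) powr (2 * \<alpha> + 1) / (q powi m)\<^sup>2) = D / \<kappa> * \<omega> (- n)"
    proof -
      have "q powi m * q powi k * (sqrt (q powi m) * \<omega> (- k)) *
        (\<omega> (- n) * (sqrt (q powi m) * D / \<kappa> * \<omega> (- k))) *
        ((q powi k) powr (2 * \<alpha> + 1) / (q powi m)\<^sup>2) =
        (sqrt (q powi m) * sqrt (q powi m) * q powi m / (q powi m)\<^sup>2) *
        (q powi k * (q powi k) powr (2 * \<alpha> + 1) * (\<omega> (- k) * \<omega> (- k))) *
        (D / \<kappa> * \<omega> (- n))"
        by (simp add: mult_ac)
      also have "sqrt (q powi m) * sqrt (q powi m) * q powi m / (q powi m)\<^sup>2 = 1"
        using q_pos by (simp add: power2_eq_square)
      also have "q powi k * (q powi k) powr (2 * \<alpha> + 1) * (\<omega> (- k) * \<omega> (- k)) = 1"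
        unfolding weight_lattice by (simp add: \<omega>_minus power2_eq_square field_simps)
      finally show ?thesis by simp
    qed
    have "(q powi m * q powi k) *\<^sub>R H (q powi m) (q powi k) =
        of_real (q powi m * q powi k * (sqrt (q powi m) * \<omega> (- k)) *
        (\<omega> (- n) * (sqrt (q powi m) * D / \<kappa> * \<omega> (- k))) *
        ((q powi k) powr (2 * \<alpha> + 1) / (q powi m)\<^sup>2)) * (?P * ?Q)"
      unfolding H_def atom transform scaleR_conv_of_real of_real_mult by (simp only: mult_ac)
    then show ?thesis
      unfolding scalar c_def T_def .
  qed
  have T: "(\<lambda>(m, k). T m k) abs_summable_on UNIV"
    unfolding T_def by (rule abs_summable_discrete_reconstruction[OF f2 \<gamma>])
  have "(\<lambda>z. norm c * norm (case z of (m, k) \<Rightarrow> T m k)) summable_on UNIV"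
    by (rule summable_on_cmult_right[OF T])
  then show "jackson_integrable2 q H"
    unfolding jackson_integrable2_def summand by (simp add: norm_mult case_prod_unfold)
  have "jackson_integral2 q H = (1 - q)\<^sup>2 *\<^sub>R (c * (\<Sum>\<^sub>\<infinity>(m, k). T m k))"
    unfolding jackson_integral2_def summand
    by (subst infsum_cmult_right'[symmetric]) (simp add: case_prod_unfold)
  also have "(\<Sum>\<^sub>\<infinity>(m, k). T m k) = of_real (\<Sum>\<^sub>\<infinity>l. (cmod (\<gamma> l))\<^sup>2) * coeffs f n"
    unfolding T_def by (rule discrete_reconstruction[OF f2 \<gamma>])
  finally have "of_real (qc q \<alpha> / wavelet_const q \<alpha> g) * jackson_integral2 q H =
      of_real (qc q \<alpha> / wavelet_const q \<alpha> g * (1 - q)\<^sup>2 * (D / \<kappa> * \<omega> (- n)) *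
        (\<Sum>\<^sub>\<infinity>l. (cmod (\<gamma> l))\<^sup>2) * \<omega> n) * f x"
    by (simp add: c_def coeffs_def n scaleR_conv_of_real mult_ac)
  also have "qc q \<alpha> / wavelet_const q \<alpha> g * (1 - q)\<^sup>2 * (D / \<kappa> * \<omega> (- n)) *
        (\<Sum>\<^sub>\<infinity>l. (cmod (\<gamma> l))\<^sup>2) * \<omega> n =
      (((1 - q) * qc q \<alpha> * D) / \<kappa>) *
      (((1 - q) * (\<Sum>\<^sub>\<infinity>l. (cmod (\<gamma> l))\<^sup>2)) / wavelet_const q \<alpha> g) * (\<omega> (- n) * \<omega> n)"
    by (simp add: power2_eq_square mult_ac)
  also have "\<dots> = 1"
    using \<kappa>_nonzero const_pos powi_pos(2)[of n]
    unfolding const[symmetric] \<kappa>_def[symmetric] by (simp add: \<omega>_minus)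
  finally show "f x = of_real (qc q \<alpha> / wavelet_const q \<alpha> g) * jackson_integral2 q H"
    by simp
qed

end

theorem theorem7:
  fixes q \<alpha> :: real and f g :: "real \<Rightarrow> complex" and x :: real
  assumes "0 < q" and "q < 1" and "ln (1 - q) / ln q \<in> \<int>" and "\<alpha> > - 1 / 2"
    and "q_wavelet q \<alpha> g"
    and "f \<in> Lq2 q \<alpha>"
    and "x \<in> Rq_pos q"
  defines "H \<equiv> \<lambda>a b. wavelet_transform q \<alpha> g f a b * wavelet_atom q \<alpha> g a b x *
                     of_real (b powr (2 * \<alpha> + 1) / a\<^sup>2)"
  shows "jackson_integrable2 q H \<and>
         f x = of_real (qc q \<alpha> / wavelet_const q \<alpha> g) * jackson_integral2 q H"
proof -
  obtain M :: int where M: "ln (1 - q) / ln q = of_int M"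
    using assms(3) by (auto elim: Ints_cases)
  have "1 - q = q powr (ln (1 - q) / ln q)"
    using assms(1,2) by (simp add: powr_def)
  then have "1 - q = q powi M"
    unfolding M using assms(1) by (simp add: powr_real_of_int')
  moreover have \<alpha>: "\<alpha> > - 1"
    using assms(4) by simp
  ultimately obtain v D B where "unitary_hankel v" "D \<noteq> 0"
    and "\<And>k. \<bar>qBessel q \<alpha> (q powi k)\<bar> \<le> B"
    and "\<And>k. qBessel q \<alpha> (q powi k) = D * (q powr (\<alpha> + 1)) powi (- k) * v k"
    using qBessel_unitary[OF assms(1,2)] by metis
  then interpret q_bessel_transform v q \<alpha> D B
    using assms(1,2) qc_nonzero[OF assms(1,2) \<alpha>]
    by (simp add: q_bessel_transform_def q_bessel_transform_axioms_def)
  show ?thesis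
    unfolding H_def using reconstruction[OF assms(5-7)] by blast
qed

end
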